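(* Let $k$ be a field and let $\mathcal{C}$ be a non-trivial 2-$k$-module. If there are an object $x\in\mathcal{C}$ and a functor $f\in\mathcal{C}^*$ with $\mathrm{id}_{\mathcal{C}}\cong x\otimes f$, then $\mathcal{C}\simeq\mathrm{Vect}$ (as 2-$k$-modules).
   Context: Fix a field $k$; all categories and functors are $k$-linear. $\mathrm{Vect}$ is the category of $k$-vector spaces. A 2-$k$-module is a $k$-linear locally presentable category; it is non-trivial if it contains a non-zero object. 2-$k$-modules form a 2-category with $k$-linear left adjoint functors as 1-morphisms and natural transformations as 2-morphisms. The dual of $\mathcal{C}$ is $\mathcal{C}^*=\mathrm{Hom}(\mathcal{C},\mathrm{Vect})$, the category of $k$-linear left adjoint functors $\mathcal{C}\to\mathrm{Vect}$. For $x\in\mathcal{C}$ and a vector space $V$, $x\otimes V$ is the copower of $x$ by $V$ (a coproduct of copies of $x$ indexed by a basis of $V$, characterized by $\mathrm{Hom}(x\otimes V,y)\cong\mathrm{Hom}_k(V,\mathrm{Hom}(x,y))$). For $x\in\mathcal{C}$ and $f\in\mathcal{C}^*$, $x\otimes f$ denotes the endofunctor $c\mapsto x\otimes f(c)$ of $\mathcal{C}$. *)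

theory Defs
  imports "HOL-Algebra.Module" "HOL-Library.FuncSet"
begin

unbundle cardinal_syntax

section \<open>Size\<close>

text \<open>
  Sizes are measured by a type \<open>'u\<close> that plays the role of a Grothendieck universe: its
  cardinality is strongly inaccessible, and a set (of elements of any type) is small if its
  cardinality is strictly below that of \<open>'u\<close>. Every small set is thus in bijection with a
  small subset of \<open>'u\<close>. The existence of such a type is not provable in HOL, just as that of an
  uncountable Grothendieck universe is not provable in ZFC.
\<close>

definition grothendieck_universe :: "'u itself \<Rightarrow> bool" where
  "grothendieck_universe U \<longleftrightarrow>
     natLeq <o |UNIV :: 'u set| \<and>
     regularCard |UNIV :: 'u set| \<and>
     (\<forall>A :: 'u set. |A| <o |UNIV :: 'u set| \<longrightarrow> |Pow A| <o |UNIV :: 'u set| )"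

definition small :: "'u itself \<Rightarrow> 'a set \<Rightarrow> bool" where
  "small U A \<longleftrightarrow> |A| <o |UNIV :: 'u set|"

definition small_regular_cardinal :: "'u rel \<Rightarrow> bool" where
  "small_regular_cardinal l \<longleftrightarrow> Cinfinite l \<and> regularCard l \<and> l <o |UNIV :: 'u set|"


section \<open>Categories and functors\<close>

text \<open>
  Hom-sets are indexed by pairs of objects and need not be disjoint, so composition takes the
  three objects as arguments: \<open>Comp C x y z g f\<close> is the composite of \<open>f\<close> from \<open>x\<close> to \<open>y\<close> and
  \<open>g\<close> from \<open>y\<close> to \<open>z\<close>.
\<close>

record ('o, 'a) cat =
  Obj :: "'o set"
  Arr :: "'o \<Rightarrow> 'o \<Rightarrow> 'a set"
  Comp :: "'o \<Rightarrow> 'o \<Rightarrow> 'o \<Rightarrow> 'a \<Rightarrow> 'a \<Rightarrow> 'a"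
  Ident :: "'o \<Rightarrow> 'a"

definition category :: "('o, 'a, 'm) cat_scheme \<Rightarrow> bool" where
  "category C \<longleftrightarrow>
     (\<forall>x\<in>Obj C. Ident C x \<in> Arr C x x) \<and>
     (\<forall>x\<in>Obj C. \<forall>y\<in>Obj C. \<forall>z\<in>Obj C. \<forall>f\<in>Arr C x y. \<forall>g\<in>Arr C y z.
        Comp C x y z g f \<in> Arr C x z) \<and>
     (\<forall>x\<in>Obj C. \<forall>y\<in>Obj C. \<forall>f\<in>Arr C x y.
        Comp C x x y f (Ident C x) = f \<and> Comp C x y y (Ident C y) f = f) \<and>
     (\<forall>w\<in>Obj C. \<forall>x\<in>Obj C. \<forall>y\<in>Obj C. \<forall>z\<in>Obj C.
        \<forall>f\<in>Arr C w x. \<forall>g\<in>Arr C x y. \<forall>h\<in>Arr C y z.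
        Comp C w x z (Comp C x y z h g) f = Comp C w y z h (Comp C w x y g f))"

definition iso_arr :: "('o, 'a, 'm) cat_scheme \<Rightarrow> 'o \<Rightarrow> 'o \<Rightarrow> 'a \<Rightarrow> bool" where
  "iso_arr C x y f \<longleftrightarrow> f \<in> Arr C x y \<and>
     (\<exists>g\<in>Arr C y x. Comp C x y x g f = Ident C x \<and> Comp C y x y f g = Ident C y)"

definition zero_object :: "('o, 'a, 'm) cat_scheme \<Rightarrow> 'o \<Rightarrow> bool" where
  "zero_object C z \<longleftrightarrow> z \<in> Obj C \<and>
     (\<forall>y\<in>Obj C. (\<exists>!f. f \<in> Arr C z y) \<and> (\<exists>!f. f \<in> Arr C y z))"

definition nontrivial :: "('o, 'a, 'm) cat_scheme \<Rightarrow> bool" where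
  "nontrivial C \<longleftrightarrow> (\<exists>x\<in>Obj C. \<not> zero_object C x)"

record ('o, 'a, 'p, 'b) ftr =
  OMap :: "'o \<Rightarrow> 'p"
  AMap :: "'o \<Rightarrow> 'o \<Rightarrow> 'a \<Rightarrow> 'b"

definition is_functor ::
  "('o, 'a, 'm) cat_scheme \<Rightarrow> ('p, 'b, 'n) cat_scheme \<Rightarrow> ('o, 'a, 'p, 'b) ftr \<Rightarrow> bool" where
  "is_functor C D F \<longleftrightarrow>
     (\<forall>x\<in>Obj C. OMap F x \<in> Obj D) \<and>
     (\<forall>x\<in>Obj C. \<forall>y\<in>Obj C. \<forall>f\<in>Arr C x y. AMap F x y f \<in> Arr D (OMap F x) (OMap F y)) \<and>
     (\<forall>x\<in>Obj C. AMap F x x (Ident C x) = Ident D (OMap F x)) \<and>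
     (\<forall>x\<in>Obj C. \<forall>y\<in>Obj C. \<forall>z\<in>Obj C. \<forall>f\<in>Arr C x y. \<forall>g\<in>Arr C y z.
        AMap F x z (Comp C x y z g f) =
        Comp D (OMap F x) (OMap F y) (OMap F z) (AMap F y z g) (AMap F x y f))"

definition id_functor :: "('o, 'a, 'o, 'a) ftr" where
  "id_functor = \<lparr>OMap = \<lambda>x. x, AMap = \<lambda>x y f. f\<rparr>"

definition comp_functor ::
  "('p, 'b, 'q, 'c) ftr \<Rightarrow> ('o, 'a, 'p, 'b) ftr \<Rightarrow> ('o, 'a, 'q, 'c) ftr" where
  "comp_functor G F =
     \<lparr>OMap = \<lambda>x. OMap G (OMap F x),
      AMap = \<lambda>x y f. AMap G (OMap F x) (OMap F y) (AMap F x y f)\<rparr>"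

definition nat_isomorphic ::
  "('o, 'a, 'm) cat_scheme \<Rightarrow> ('p, 'b, 'n) cat_scheme \<Rightarrow>
   ('o, 'a, 'p, 'b) ftr \<Rightarrow> ('o, 'a, 'p, 'b) ftr \<Rightarrow> bool" where
  "nat_isomorphic C D F G \<longleftrightarrow> (\<exists>\<eta>.
     (\<forall>x\<in>Obj C. iso_arr D (OMap F x) (OMap G x) (\<eta> x)) \<and>
     (\<forall>x\<in>Obj C. \<forall>y\<in>Obj C. \<forall>f\<in>Arr C x y.
        Comp D (OMap F x) (OMap F y) (OMap G y) (\<eta> y) (AMap F x y f) =
        Comp D (OMap F x) (OMap G x) (OMap G y) (AMap G x y f) (\<eta> x)))"

definition left_adjoint ::
  "('o, 'a, 'm) cat_scheme \<Rightarrow> ('p, 'b, 'n) cat_scheme \<Rightarrow> ('o, 'a, 'p, 'b) ftr \<Rightarrow> bool" where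
  "left_adjoint C D F \<longleftrightarrow> is_functor C D F \<and> (\<exists>G \<phi>. is_functor D C G \<and>
     (\<forall>c\<in>Obj C. \<forall>d\<in>Obj D.
        bij_betw (\<phi> c d) (Arr D (OMap F c) d) (Arr C c (OMap G d))) \<and>
     (\<forall>c\<in>Obj C. \<forall>c'\<in>Obj C. \<forall>d\<in>Obj D. \<forall>d'\<in>Obj D.
        \<forall>u\<in>Arr C c' c. \<forall>g\<in>Arr D (OMap F c) d. \<forall>w\<in>Arr D d d'.
        \<phi> c' d' (Comp D (OMap F c') (OMap F c) d' (Comp D (OMap F c) d d' w g) (AMap F c' c u)) =
        Comp C c' c (OMap G d')
          (Comp C c (OMap G d) (OMap G d') (AMap G d d' w) (\<phi> c d g)) u))"


section \<open>Locally presentable categories\<close>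

definition all_arrows :: "('o, 'a, 'm) cat_scheme \<Rightarrow> ('o \<times> 'o \<times> 'a) set" where
  "all_arrows C = {(x, y, f). x \<in> Obj C \<and> y \<in> Obj C \<and> f \<in> Arr C x y}"

definition is_cocone ::
  "('j, 'i) cat \<Rightarrow> ('o, 'a, 'm) cat_scheme \<Rightarrow> ('j, 'i, 'o, 'a) ftr \<Rightarrow> 'o \<Rightarrow> ('j \<Rightarrow> 'a) \<Rightarrow> bool"
  where
  "is_cocone J C D c \<iota> \<longleftrightarrow> c \<in> Obj C \<and>
     (\<forall>j\<in>Obj J. \<iota> j \<in> Arr C (OMap D j) c) \<and>
     (\<forall>i\<in>Obj J. \<forall>j\<in>Obj J. \<forall>u\<in>Arr J i j.
        Comp C (OMap D i) (OMap D j) c (\<iota> j) (AMap D i j u) = \<iota> i)"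

definition is_colimit ::
  "('j, 'i) cat \<Rightarrow> ('o, 'a, 'm) cat_scheme \<Rightarrow> ('j, 'i, 'o, 'a) ftr \<Rightarrow> 'o \<Rightarrow> ('j \<Rightarrow> 'a) \<Rightarrow> bool"
  where
  "is_colimit J C D c \<iota> \<longleftrightarrow> is_cocone J C D c \<iota> \<and>
     (\<forall>d \<tau>. is_cocone J C D d \<tau> \<longrightarrow>
        (\<exists>!h. h \<in> Arr C c d \<and> (\<forall>j\<in>Obj J. Comp C (OMap D j) c d h (\<iota> j) = \<tau> j)))"

text \<open>
  Up to isomorphism, every small category has its objects and arrows in \<open>'u\<close>, so only diagram
  shapes of this form are considered.
\<close>

definition small_category :: "('u, 'u) cat \<Rightarrow> bool" where
  "small_category J \<longleftrightarrow> category J \<and> small TYPE('u) (all_arrows J)"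

definition cocomplete :: "'u itself \<Rightarrow> ('o, 'a, 'm) cat_scheme \<Rightarrow> bool" where
  "cocomplete U C \<longleftrightarrow> (\<forall>(J :: ('u, 'u) cat) D.
     small_category J \<and> is_functor J C D \<longrightarrow> (\<exists>c \<iota>. is_colimit J C D c \<iota>))"

text \<open>\<open>J\<close> is \<open>l\<close>-filtered if every diagram in \<open>J\<close> with fewer than \<open>l\<close> arrows has a cocone.\<close>

definition filtered :: "'u rel \<Rightarrow> ('u, 'u) cat \<Rightarrow> bool" where
  "filtered l J \<longleftrightarrow> category J \<and>
     (\<forall>(I :: ('u, 'u) cat) D. category I \<and> |all_arrows I| <o l \<and> is_functor I J D \<longrightarrow>
        (\<exists>c \<iota>. is_cocone I J D c \<iota>))"

text \<open>
  The functor \<open>Arr C x\<close> to sets takes the cocone \<open>(c, \<iota>)\<close> to a colimit cocone in the category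
  of small sets; the vertices of the competing cocones may be taken to be subsets of \<open>'u\<close>.
\<close>

definition hom_image_is_colimit ::
  "('u, 'u) cat \<Rightarrow> ('o, 'a, 'm) cat_scheme \<Rightarrow> ('u, 'u, 'o, 'a) ftr \<Rightarrow> 'o \<Rightarrow> ('u \<Rightarrow> 'a) \<Rightarrow> 'o \<Rightarrow> bool"
  where
  "hom_image_is_colimit J C D c \<iota> x \<longleftrightarrow> (\<forall>(Y :: 'u set) \<tau>.
     small TYPE('u) Y \<and>
     (\<forall>j\<in>Obj J. \<tau> j \<in> Arr C x (OMap D j) \<rightarrow> Y) \<and>
     (\<forall>i\<in>Obj J. \<forall>j\<in>Obj J. \<forall>u\<in>Arr J i j. \<forall>g\<in>Arr C x (OMap D i).
        \<tau> j (Comp C x (OMap D i) (OMap D j) (AMap D i j u) g) = \<tau> i g) \<longrightarrow>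
     (\<exists>!h. h \<in> Arr C x c \<rightarrow>\<^sub>E Y \<and>
        (\<forall>j\<in>Obj J. \<forall>g\<in>Arr C x (OMap D j). h (Comp C x (OMap D j) c (\<iota> j) g) = \<tau> j g)))"

definition presentable :: "'u rel \<Rightarrow> ('o, 'a, 'm) cat_scheme \<Rightarrow> 'o \<Rightarrow> bool" where
  "presentable l C x \<longleftrightarrow> x \<in> Obj C \<and>
     (\<forall>(J :: ('u, 'u) cat) D c \<iota>.
        small_category J \<and> filtered l J \<and> is_functor J C D \<and> is_colimit J C D c \<iota> \<longrightarrow>
        hom_image_is_colimit J C D c \<iota> x)"

definition locally_presentable :: "'u itself \<Rightarrow> ('o, 'a, 'm) cat_scheme \<Rightarrow> bool" where
  "locally_presentable U C \<longleftrightarrow> category C \<and>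
     (\<forall>x\<in>Obj C. \<forall>y\<in>Obj C. small U (Arr C x y)) \<and>
     cocomplete U C \<and>
     (\<exists>(l :: 'u rel) S. small_regular_cardinal l \<and> small U S \<and> (\<forall>s\<in>S. presentable l C s) \<and>
        (\<forall>c\<in>Obj C. \<exists>(J :: ('u, 'u) cat) D \<iota>. small_category J \<and> filtered l J \<and>
           is_functor J C D \<and> (\<forall>j\<in>Obj J. OMap D j \<in> S) \<and> is_colimit J C D c \<iota>))"


section \<open>Linear categories\<close>

text \<open>
  A vector space over the field \<open>K\<close> is a \<open>module K V\<close>; the ring multiplication and unit that the
  record \<open>V\<close> also carries are ignored throughout.
\<close>

definition is_linear ::
  "('k, 'r) ring_scheme \<Rightarrow> ('k, 'v) module \<Rightarrow> ('k, 'w) module \<Rightarrow> ('v \<Rightarrow> 'w) \<Rightarrow> bool" where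
  "is_linear K V W f \<longleftrightarrow> f \<in> carrier V \<rightarrow> carrier W \<and>
     (\<forall>u\<in>carrier V. \<forall>v\<in>carrier V. f (u \<oplus>\<^bsub>V\<^esub> v) = f u \<oplus>\<^bsub>W\<^esub> f v) \<and>
     (\<forall>a\<in>carrier K. \<forall>v\<in>carrier V. f (a \<odot>\<^bsub>V\<^esub> v) = a \<odot>\<^bsub>W\<^esub> f v)"

text \<open>Linear maps as set-theoretic functions, i.e. \<open>undefined\<close> outside of \<open>carrier V\<close>.\<close>

definition lin_maps ::
  "('k, 'r) ring_scheme \<Rightarrow> ('k, 'v) module \<Rightarrow> ('k, 'w) module \<Rightarrow> ('v \<Rightarrow> 'w) set" where
  "lin_maps K V W = {f \<in> extensional (carrier V). is_linear K V W f}"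

definition lin_maps_space ::
  "('k, 'r) ring_scheme \<Rightarrow> ('k, 'v) module \<Rightarrow> ('k, 'w) module \<Rightarrow> ('k, 'v \<Rightarrow> 'w) module" where
  "lin_maps_space K V W =
     \<lparr>carrier = lin_maps K V W, monoid.mult = undefined, one = undefined,
      zero = (\<lambda>v\<in>carrier V. \<zero>\<^bsub>W\<^esub>), add = (\<lambda>f g. \<lambda>v\<in>carrier V. f v \<oplus>\<^bsub>W\<^esub> g v),
      smult = (\<lambda>a f. \<lambda>v\<in>carrier V. a \<odot>\<^bsub>W\<^esub> f v)\<rparr>"

record ('o, 'a, 'k) lin_cat = "('o, 'a) cat" +
  HomSp :: "'o \<Rightarrow> 'o \<Rightarrow> ('k, 'a) module"

definition linear_category :: "('k, 'r) ring_scheme \<Rightarrow> ('o, 'a, 'k) lin_cat \<Rightarrow> bool" where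
  "linear_category K C \<longleftrightarrow> category C \<and>
     (\<forall>x\<in>Obj C. \<forall>y\<in>Obj C. module K (HomSp C x y) \<and> carrier (HomSp C x y) = Arr C x y) \<and>
     (\<forall>x\<in>Obj C. \<forall>y\<in>Obj C. \<forall>z\<in>Obj C.
        (\<forall>f\<in>Arr C x y. is_linear K (HomSp C y z) (HomSp C x z) (\<lambda>g. Comp C x y z g f)) \<and>
        (\<forall>g\<in>Arr C y z. is_linear K (HomSp C x y) (HomSp C x z) (\<lambda>f. Comp C x y z g f)))"

definition linear_functor ::
  "('k, 'r) ring_scheme \<Rightarrow> ('o, 'a, 'k) lin_cat \<Rightarrow> ('p, 'b, 'k) lin_cat \<Rightarrow>
   ('o, 'a, 'p, 'b) ftr \<Rightarrow> bool" where
  "linear_functor K C D F \<longleftrightarrow> is_functor C D F \<and>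
     (\<forall>x\<in>Obj C. \<forall>y\<in>Obj C.
        is_linear K (HomSp C x y) (HomSp D (OMap F x) (OMap F y)) (AMap F x y))"

text \<open>
  The category of small vector spaces over \<open>K\<close>, with underlying sets taken in \<open>'u\<close>. Smallness of
  \<open>K\<close> need not be assumed: over a field that is not small every small vector space is zero.
\<close>

definition Vect :: "('k, 'r) ring_scheme \<Rightarrow> (('k, 'u) module, 'u \<Rightarrow> 'u, 'k) lin_cat" where
  "Vect K =
     \<lparr>Obj = {V. module K V \<and> small TYPE('u) (carrier V)},
      Arr = lin_maps K,
      Comp = (\<lambda>U V W g f. compose (carrier U) g f),
      Ident = (\<lambda>V. \<lambda>v\<in>carrier V. v),
      HomSp = lin_maps_space K\<rparr>"


section \<open>2-modules\<close>

definition two_module ::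
  "'u itself \<Rightarrow> ('k, 'r) ring_scheme \<Rightarrow> ('o, 'a, 'k) lin_cat \<Rightarrow> bool" where
  "two_module U K C \<longleftrightarrow> linear_category K C \<and> locally_presentable U C"

definition two_module_hom ::
  "('k, 'r) ring_scheme \<Rightarrow> ('o, 'a, 'k) lin_cat \<Rightarrow> ('p, 'b, 'k) lin_cat \<Rightarrow>
   ('o, 'a, 'p, 'b) ftr set" where
  "two_module_hom K C D = {F. linear_functor K C D F \<and> left_adjoint C D F}"

definition dual ::
  "('k, 'r) ring_scheme \<Rightarrow> ('o, 'a, 'k) lin_cat \<Rightarrow> ('o, 'a, ('k, 'u) module, 'u \<Rightarrow> 'u) ftr set"
  where
  "dual K C = two_module_hom K C (Vect K)"

definition two_module_equivalent ::
  "('k, 'r) ring_scheme \<Rightarrow> ('o, 'a, 'k) lin_cat \<Rightarrow> ('p, 'b, 'k) lin_cat \<Rightarrow> bool" where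
  "two_module_equivalent K C D \<longleftrightarrow>
     (\<exists>F\<in>two_module_hom K C D. \<exists>G\<in>two_module_hom K D C.
        nat_isomorphic C C id_functor (comp_functor G F) \<and>
        nat_isomorphic D D (comp_functor F G) id_functor)"

text \<open>
  \<open>p\<close> is the copower of \<open>x\<close> by \<open>V\<close>: composition with the linear map \<open>\<iota>\<close> from \<open>V\<close> to the space of
  arrows from \<open>x\<close> to \<open>p\<close>, which corresponds to the identity of \<open>p\<close>, is a bijection, natural in
  \<open>y\<close>, from the arrows \<open>p\<close> to \<open>y\<close> to the linear maps from \<open>V\<close> to the space of arrows \<open>x\<close> to \<open>y\<close>.
\<close>

definition is_copower ::
  "('k, 'r) ring_scheme \<Rightarrow> ('o, 'a, 'k) lin_cat \<Rightarrow> 'o \<Rightarrow> ('k, 'v) module \<Rightarrow> 'o \<Rightarrow> ('v \<Rightarrow> 'a) \<Rightarrow> bool"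
  where
  "is_copower K C x V p \<iota> \<longleftrightarrow> p \<in> Obj C \<and> is_linear K V (HomSp C x p) \<iota> \<and>
     (\<forall>y\<in>Obj C. bij_betw (\<lambda>h. \<lambda>v\<in>carrier V. Comp C x p y h (\<iota> v))
        (Arr C p y) (lin_maps K V (HomSp C x y)))"

text \<open>
  \<open>T\<close> is the endofunctor sending \<open>c\<close> to the copower of \<open>x\<close> by \<open>f c\<close>, formed with respect to an
  arbitrary choice \<open>\<iota>\<close> of copowers; the last clause says that an arrow \<open>u\<close> is sent to the arrow
  induced by the linear map \<open>f u\<close>.
\<close>

definition is_tensor_functor ::
  "('k, 'r) ring_scheme \<Rightarrow> ('o, 'a, 'k) lin_cat \<Rightarrow> 'o \<Rightarrow>
   ('o, 'a, ('k, 'v) module, 'v \<Rightarrow> 'v) ftr \<Rightarrow> ('o, 'a, 'o, 'a) ftr \<Rightarrow> ('o \<Rightarrow> 'v \<Rightarrow> 'a) \<Rightarrow> bool" where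
  "is_tensor_functor K C x f T \<iota> \<longleftrightarrow> is_functor C C T \<and>
     (\<forall>c\<in>Obj C. is_copower K C x (OMap f c) (OMap T c) (\<iota> c)) \<and>
     (\<forall>c\<in>Obj C. \<forall>d\<in>Obj C. \<forall>u\<in>Arr C c d. \<forall>v\<in>carrier (OMap f c).
        Comp C x (OMap T c) (OMap T d) (AMap T c d u) (\<iota> c v) = \<iota> d (AMap f c d u v))"

end

theory Submission
  imports Defs
begin

text \<open>
  An isomorphism of the identity with \<open>x \<otimes> f\<close> makes every object \<open>c\<close> itself a copower of \<open>x\<close>
  by \<open>f c\<close>, by maps \<open>\<sigma> c\<close> from \<open>f c\<close> to the arrows from \<open>x\<close> to \<open>c\<close> such that
  \<open>u \<circ> \<sigma> c v = \<sigma> d (f u v)\<close> for all \<open>u\<close> from \<open>c\<close> to \<open>d\<close>. As \<open>x\<close> is not zero, linear forms on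
  \<open>f c\<close> show that \<open>\<sigma> c\<close> is injective, and so the universal property of \<open>c\<close> makes \<open>f\<close> fully
  faithful. The endomorphisms of \<open>x\<close> commute because each of them extends to an endomorphism of
  the identity functor. Hence the endomorphisms of the non-zero vector space \<open>f x\<close> commute, and
  \<open>f x\<close> is a line. Since all linear maps from \<open>f x\<close> to \<open>W\<close> then factor uniquely through the
  counit from \<open>f (g W)\<close> to \<open>W\<close>, where \<open>g\<close> is right adjoint to \<open>f\<close>, the counit is bijective and
  \<open>f\<close> is essentially surjective.
\<close>

section \<open>Linear maps\<close>

lemma is_linearD:
  assumes "is_linear K V W f"
  shows is_linear_closed: "v \<in> carrier V \<Longrightarrow> f v \<in> carrier W"
    and is_linear_add:
      "u \<in> carrier V \<Longrightarrow> v \<in> carrier V \<Longrightarrow> f (u \<oplus>\<^bsub>V\<^esub> v) = f u \<oplus>\<^bsub>W\<^esub> f v"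
    and is_linear_smult:
      "a \<in> carrier K \<Longrightarrow> v \<in> carrier V \<Longrightarrow> f (a \<odot>\<^bsub>V\<^esub> v) = a \<odot>\<^bsub>W\<^esub> f v"
  using assms by (auto simp: is_linear_def)

lemma is_linear_compose:
  assumes "is_linear K U V f" "is_linear K V W g"
  shows "is_linear K U W (\<lambda>u. g (f u))"
  using assms by (auto simp: is_linear_def Pi_iff)

lemma is_linear_cong:
  assumes "is_linear K V W f" "module K V" "\<And>v. v \<in> carrier V \<Longrightarrow> g v = f v"
  shows "is_linear K V W g"
proof -
  interpret module K V by fact
  show ?thesis
    using assms(1,3) by (auto simp: is_linear_def)
qed

lemma restrict_in_lin_maps:
  assumes "is_linear K V W f" "module K V"
  shows "restrict f (carrier V) \<in> lin_maps K V W"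
  using is_linear_cong[OF assms] by (simp add: lin_maps_def)

lemma lin_maps_linear: "f \<in> lin_maps K V W \<Longrightarrow> is_linear K V W f"
  by (simp add: lin_maps_def)

lemma lin_maps_extensional: "f \<in> lin_maps K V W \<Longrightarrow> f \<in> extensional (carrier V)"
  by (simp add: lin_maps_def)

lemma lin_maps_eqI:
  assumes "f \<in> lin_maps K V W" "g \<in> lin_maps K V W'" "\<And>v. v \<in> carrier V \<Longrightarrow> f v = g v"
  shows "f = g"
  using assms by (auto simp: lin_maps_def intro: extensionalityI)

lemma is_linear_zero:
  assumes "is_linear K V W f" "module K V" "module K W"
  shows "f \<zero>\<^bsub>V\<^esub> = \<zero>\<^bsub>W\<^esub>"
proof -
  interpret V: module K V by fact
  interpret W: module K W by fact
  show ?thesis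
    using is_linear_smult[OF assms(1) V.R.zero_closed V.M.zero_closed] is_linear_closed[OF assms(1)]
    by simp
qed

lemma module_lin_maps_space:
  assumes "module K V" "module K W"
  shows "module K (lin_maps_space K V W)"
proof -
  interpret V: module K V by fact
  interpret W: module K W by fact
  let ?L = "lin_maps_space K V W"
  have neg: "(\<lambda>v\<in>carrier V. \<ominus>\<^bsub>W\<^esub> f v) \<in> lin_maps K V W" if "f \<in> lin_maps K V W" for f
    using that
    by (auto simp: lin_maps_def is_linear_def Pi_iff W.minus_add W.smult_r_minus)
  have comm: "a \<odot>\<^bsub>W\<^esub> (b \<odot>\<^bsub>W\<^esub> w) = b \<odot>\<^bsub>W\<^esub> (a \<odot>\<^bsub>W\<^esub> w)"
    if "a \<in> carrier K" "b \<in> carrier K" "w \<in> carrier W" for a b w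
    using that W.smult_assoc1[of a b w] W.smult_assoc1[of b a w] by (simp add: V.R.m_comm)
  show ?thesis
  proof (rule moduleI)
    show "cring K" by (rule V.is_cring)
    show "abelian_group ?L"
    proof (rule abelian_groupI)
      show "\<exists>g\<in>carrier ?L. g \<oplus>\<^bsub>?L\<^esub> f = \<zero>\<^bsub>?L\<^esub>" if "f \<in> carrier ?L" for f
        using that neg[of f]
        by (intro bexI[of _ "\<lambda>v\<in>carrier V. \<ominus>\<^bsub>W\<^esub> f v"])
           (auto simp: lin_maps_space_def lin_maps_def is_linear_def Pi_iff W.l_neg
             intro!: restrict_ext)
    qed (auto simp: lin_maps_space_def lin_maps_def is_linear_def Pi_iff W.a_ac W.smult_r_distr
          extensional_def restrict_def)
  qed (auto simp: lin_maps_space_def lin_maps_def is_linear_def Pi_iff extensional_def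
      W.smult_l_distr W.smult_r_distr W.smult_assoc1 restrict_def W.a_ac comm)
qed

definition linear_form :: "('k, 'r) ring_scheme \<Rightarrow> ('k, 'v) module \<Rightarrow> ('v \<Rightarrow> 'k) \<Rightarrow> bool" where
  "linear_form K V l \<longleftrightarrow> l \<in> carrier V \<rightarrow> carrier K \<and>
     (\<forall>u\<in>carrier V. \<forall>v\<in>carrier V. l (u \<oplus>\<^bsub>V\<^esub> v) = l u \<oplus>\<^bsub>K\<^esub> l v) \<and>
     (\<forall>a\<in>carrier K. \<forall>v\<in>carrier V. l (a \<odot>\<^bsub>V\<^esub> v) = a \<otimes>\<^bsub>K\<^esub> l v)"

lemma linear_form_smult:
  assumes "linear_form K V l" "module K W" "w \<in> carrier W"
  shows "is_linear K V W (\<lambda>v. l v \<odot>\<^bsub>W\<^esub> w)"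
proof -
  interpret module K W by fact
  show ?thesis
    using assms by (auto simp: linear_form_def is_linear_def Pi_iff smult_l_distr smult_assoc1)
qed

lemma (in abelian_group) eq_if_minus_eq_zero:
  assumes "a \<in> carrier G" "b \<in> carrier G" "a \<ominus> b = \<zero>"
  shows "a = b"
proof -
  have "a = a \<ominus> b \<oplus> b"
    using assms(1,2) by (simp add: minus_eq a_assoc l_neg)
  then show ?thesis
    using assms by simp
qed

text \<open>
  A submodule that is maximal among those not containing \<open>w\<close> is a complement of the line
  through \<open>w\<close>.
\<close>

lemma ex_linear_form:
  fixes V :: "('k, 'v) module"
  assumes "field K" "module K V" "w \<in> carrier V" "w \<noteq> \<zero>\<^bsub>V\<^esub>"
  obtains l where "linear_form K V l" "l w = \<one>\<^bsub>K\<^esub>"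
proof -
  interpret K: field K by fact
  interpret V: module K V by fact
  define S where "S = {N. submodule N K V \<and> w \<notin> N}"
  have "{\<zero>\<^bsub>V\<^esub>} \<in> S"
    using assms by (auto simp: S_def intro!: V.submoduleI)
  moreover have "\<Union>\<C> \<in> S" if "\<C> \<noteq> {}" "subset.chain S \<C>" for \<C>
  proof -
    have sub: "submodule N K V" if "N \<in> \<C>" for N
      using that \<open>subset.chain S \<C>\<close> by (auto simp: subset.chain_def S_def)
    have *: "\<exists>N\<in>\<C>. a \<in> N \<and> b \<in> N" if ab: "a \<in> \<Union>\<C>" "b \<in> \<Union>\<C>" for a b
    proof -
      obtain A B where AB: "A \<in> \<C>" "B \<in> \<C>" "a \<in> A" "b \<in> B"
        using ab by blast
      moreover have "A \<subseteq> B \<or> B \<subseteq> A"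
        using \<open>subset.chain S \<C>\<close> AB(1,2) by (simp add: subset_chain_def)
      ultimately show ?thesis by blast
    qed
    obtain N where N: "N \<in> \<C>"
      using \<open>\<C> \<noteq> {}\<close> by blast
    have "submodule (\<Union>\<C>) K V"
    proof (rule V.submoduleI)
      show "\<Union>\<C> \<subseteq> carrier V"
        using V.submoduleE(1)[OF sub] by blast
      show "\<zero>\<^bsub>V\<^esub> \<in> \<Union>\<C>"
        using N subgroup.one_closed[OF submodule.axioms(1)[OF sub[OF N]]] by auto
      show "\<ominus>\<^bsub>V\<^esub> a \<in> \<Union>\<C>" if "a \<in> \<Union>\<C>" for a
        using that V.submoduleE(3)[OF sub] by blast
      show "a \<oplus>\<^bsub>V\<^esub> b \<in> \<Union>\<C>" if "a \<in> \<Union>\<C>" "b \<in> \<Union>\<C>" for a b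
        using *[OF that] V.submoduleE(5)[OF sub] by blast
      show "a \<odot>\<^bsub>V\<^esub> b \<in> \<Union>\<C>" if "a \<in> carrier K" "b \<in> \<Union>\<C>" for a b
        using that V.submoduleE(4)[OF sub] by blast
    qed
    then show ?thesis
      using \<open>subset.chain S \<C>\<close> by (auto simp: S_def subset.chain_def)
  qed
  ultimately obtain N where "N \<in> S" and max: "\<And>X. X \<in> S \<Longrightarrow> N \<subseteq> X \<Longrightarrow> X = N"
    using subset_Zorn_nonempty[of S] by blast
  then have N: "submodule N K V" and w: "w \<notin> N"
    by (auto simp: S_def)
  note NE = V.submoduleE[OF N]
  have NV: "n \<in> carrier V" if "n \<in> N" for n
    using that NE(1) by blast
  have zN: "\<zero>\<^bsub>V\<^esub> \<in> N"
    using subgroup.one_closed[OF submodule.axioms(1)[OF N]] by simp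
  have neg0: "\<ominus>\<^bsub>V\<^esub> \<zero>\<^bsub>V\<^esub> = \<zero>\<^bsub>V\<^esub>"
    using V.r_neg[of "\<zero>\<^bsub>V\<^esub>"] by simp
  have ex: "\<exists>a. a \<in> carrier K \<and> u \<ominus>\<^bsub>V\<^esub> a \<odot>\<^bsub>V\<^esub> w \<in> N" if u: "u \<in> carrier V" for u
  proof (cases "u \<in> N")
    case True
    then show ?thesis
      using assms u by (intro exI[of _ "\<zero>\<^bsub>K\<^esub>"]) (simp add: V.minus_eq neg0)
  next
    case False
    let ?X = "{n \<oplus>\<^bsub>V\<^esub> a \<odot>\<^bsub>V\<^esub> u | n a. n \<in> N \<and> a \<in> carrier K}"
    have "submodule ?X K V"
    proof (rule V.submoduleI)
      show "?X \<subseteq> carrier V"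
        using NV u by auto
      show "\<zero>\<^bsub>V\<^esub> \<in> ?X"
        using zN u by (auto intro!: exI[of _ "\<zero>\<^bsub>V\<^esub>"] exI[of _ "\<zero>\<^bsub>K\<^esub>"])
      show "\<ominus>\<^bsub>V\<^esub> b \<in> ?X" if "b \<in> ?X" for b
      proof -
        obtain n a where "b = n \<oplus>\<^bsub>V\<^esub> a \<odot>\<^bsub>V\<^esub> u" "n \<in> N" "a \<in> carrier K"
          using \<open>b \<in> ?X\<close> by blast
        then have "\<ominus>\<^bsub>V\<^esub> b = \<ominus>\<^bsub>V\<^esub> n \<oplus>\<^bsub>V\<^esub> (\<ominus>\<^bsub>K\<^esub> a) \<odot>\<^bsub>V\<^esub> u" "\<ominus>\<^bsub>V\<^esub> n \<in> N" "\<ominus>\<^bsub>K\<^esub> a \<in> carrier K"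
          using u NE(3) NV by (auto simp: V.minus_add V.smult_l_minus)
        then show ?thesis by blast
      qed
      show "b \<oplus>\<^bsub>V\<^esub> c \<in> ?X" if "b \<in> ?X" "c \<in> ?X" for b c
      proof -
        obtain n a where b: "b = n \<oplus>\<^bsub>V\<^esub> a \<odot>\<^bsub>V\<^esub> u" "n \<in> N" "a \<in> carrier K"
          using \<open>b \<in> ?X\<close> by blast
        obtain m d where c: "c = m \<oplus>\<^bsub>V\<^esub> d \<odot>\<^bsub>V\<^esub> u" "m \<in> N" "d \<in> carrier K"
          using \<open>c \<in> ?X\<close> by blast
        have "b \<oplus>\<^bsub>V\<^esub> c = (n \<oplus>\<^bsub>V\<^esub> m) \<oplus>\<^bsub>V\<^esub> (a \<oplus>\<^bsub>K\<^esub> d) \<odot>\<^bsub>V\<^esub> u"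
          using b c u NV by (simp add: V.smult_l_distr V.a_ac)
        moreover have "n \<oplus>\<^bsub>V\<^esub> m \<in> N" "a \<oplus>\<^bsub>K\<^esub> d \<in> carrier K"
          using b c NE(5) by auto
        ultimately show ?thesis by blast
      qed
      show "d \<odot>\<^bsub>V\<^esub> b \<in> ?X" if d: "d \<in> carrier K" and "b \<in> ?X" for d b
      proof -
        obtain n a where b: "b = n \<oplus>\<^bsub>V\<^esub> a \<odot>\<^bsub>V\<^esub> u" "n \<in> N" "a \<in> carrier K"
          using \<open>b \<in> ?X\<close> by blast
        have "d \<odot>\<^bsub>V\<^esub> b = d \<odot>\<^bsub>V\<^esub> n \<oplus>\<^bsub>V\<^esub> (d \<otimes>\<^bsub>K\<^esub> a) \<odot>\<^bsub>V\<^esub> u"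
          using b d u NV by (simp add: V.smult_r_distr V.smult_assoc1)
        moreover have "d \<odot>\<^bsub>V\<^esub> n \<in> N" "d \<otimes>\<^bsub>K\<^esub> a \<in> carrier K"
          using b d NE(4) by auto
        ultimately show ?thesis by blast
      qed
    qed
    moreover have "N \<subseteq> ?X"
    proof
      fix n assume "n \<in> N"
      then have "n = n \<oplus>\<^bsub>V\<^esub> \<zero>\<^bsub>K\<^esub> \<odot>\<^bsub>V\<^esub> u"
        using u NV by simp
      then show "n \<in> ?X"
        using \<open>n \<in> N\<close> by blast
    qed
    moreover have "u \<in> ?X"
    proof -
      have "u = \<zero>\<^bsub>V\<^esub> \<oplus>\<^bsub>V\<^esub> \<one>\<^bsub>K\<^esub> \<odot>\<^bsub>V\<^esub> u"
        using u by simp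
      then show ?thesis
        using zN by blast
    qed
    ultimately have "w \<in> ?X"
      using max[of ?X] False by (auto simp: S_def)
    then obtain n a where na: "w = n \<oplus>\<^bsub>V\<^esub> a \<odot>\<^bsub>V\<^esub> u" "n \<in> N" "a \<in> carrier K"
      by blast
    have "a \<noteq> \<zero>\<^bsub>K\<^esub>"
      using na w u NV by auto
    then have a: "inv\<^bsub>K\<^esub> a \<in> carrier K" "inv\<^bsub>K\<^esub> a \<otimes>\<^bsub>K\<^esub> a = \<one>\<^bsub>K\<^esub>"
      using na K.field_Units by auto
    let ?m = "inv\<^bsub>K\<^esub> a \<odot>\<^bsub>V\<^esub> n"
    have m: "?m \<in> carrier V"
      using a na NV by simp
    have "inv\<^bsub>K\<^esub> a \<odot>\<^bsub>V\<^esub> w = ?m \<oplus>\<^bsub>V\<^esub> u"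
      using a na u NV by (simp add: V.smult_r_distr V.smult_assoc1[symmetric])
    then have "u \<ominus>\<^bsub>V\<^esub> inv\<^bsub>K\<^esub> a \<odot>\<^bsub>V\<^esub> w = \<ominus>\<^bsub>V\<^esub> ?m"
      using m u by (simp add: V.minus_eq V.minus_add V.a_comm V.r_neg2)
    moreover have "\<ominus>\<^bsub>V\<^esub> ?m \<in> N"
      using a na NE(3,4) by simp
    ultimately show ?thesis
      using a by auto
  qed
  have uniq: "a = b"
    if "a \<in> carrier K" "b \<in> carrier K" "u \<in> carrier V"
      "u \<ominus>\<^bsub>V\<^esub> a \<odot>\<^bsub>V\<^esub> w \<in> N" "u \<ominus>\<^bsub>V\<^esub> b \<odot>\<^bsub>V\<^esub> w \<in> N" for a b u
  proof (rule ccontr)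
    assume "a \<noteq> b"
    then have "a \<ominus>\<^bsub>K\<^esub> b \<noteq> \<zero>\<^bsub>K\<^esub>"
      using that K.eq_if_minus_eq_zero by blast
    then have c: "inv\<^bsub>K\<^esub> (a \<ominus>\<^bsub>K\<^esub> b) \<in> carrier K" "inv\<^bsub>K\<^esub> (a \<ominus>\<^bsub>K\<^esub> b) \<otimes>\<^bsub>K\<^esub> (a \<ominus>\<^bsub>K\<^esub> b) = \<one>\<^bsub>K\<^esub>"
      using that K.field_Units by auto
    have "(u \<ominus>\<^bsub>V\<^esub> b \<odot>\<^bsub>V\<^esub> w) \<oplus>\<^bsub>V\<^esub> \<ominus>\<^bsub>V\<^esub> (u \<ominus>\<^bsub>V\<^esub> a \<odot>\<^bsub>V\<^esub> w) \<in> N"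
      using that NE(3,5) by simp
    also have "(u \<ominus>\<^bsub>V\<^esub> b \<odot>\<^bsub>V\<^esub> w) \<oplus>\<^bsub>V\<^esub> \<ominus>\<^bsub>V\<^esub> (u \<ominus>\<^bsub>V\<^esub> a \<odot>\<^bsub>V\<^esub> w) = (a \<ominus>\<^bsub>K\<^esub> b) \<odot>\<^bsub>V\<^esub> w"
      using that assms
      by (simp add: V.minus_eq K.minus_eq V.minus_add V.smult_l_distr V.smult_l_minus V.a_ac
          V.r_neg2)
    finally have "inv\<^bsub>K\<^esub> (a \<ominus>\<^bsub>K\<^esub> b) \<odot>\<^bsub>V\<^esub> ((a \<ominus>\<^bsub>K\<^esub> b) \<odot>\<^bsub>V\<^esub> w) \<in> N"
      using c NE(4) by simp
    then show False
      using c w assms that by (simp add: V.smult_assoc1[symmetric])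
  qed
  define l where "l u = (SOME a. a \<in> carrier K \<and> u \<ominus>\<^bsub>V\<^esub> a \<odot>\<^bsub>V\<^esub> w \<in> N)" for u
  have l: "l u \<in> carrier K" "u \<ominus>\<^bsub>V\<^esub> l u \<odot>\<^bsub>V\<^esub> w \<in> N" if "u \<in> carrier V" for u
    using someI_ex[OF ex[OF that]] by (auto simp: l_def)
  have leq: "l u = a" if "u \<in> carrier V" "a \<in> carrier K" "u \<ominus>\<^bsub>V\<^esub> a \<odot>\<^bsub>V\<^esub> w \<in> N" for u a
    using uniq[of "l u" a u] l[of u] that by blast
  have "linear_form K V l"
    unfolding linear_form_def
  proof (intro conjI ballI)
    show "l \<in> carrier V \<rightarrow> carrier K"
      using l by blast
    fix v assume v: "v \<in> carrier V"
    show "l (u \<oplus>\<^bsub>V\<^esub> v) = l u \<oplus>\<^bsub>K\<^esub> l v" if u: "u \<in> carrier V" for u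
    proof (rule leq)
      have "(u \<ominus>\<^bsub>V\<^esub> l u \<odot>\<^bsub>V\<^esub> w) \<oplus>\<^bsub>V\<^esub> (v \<ominus>\<^bsub>V\<^esub> l v \<odot>\<^bsub>V\<^esub> w) \<in> N"
        using u v l NE(5) by simp
      then show "u \<oplus>\<^bsub>V\<^esub> v \<ominus>\<^bsub>V\<^esub> (l u \<oplus>\<^bsub>K\<^esub> l v) \<odot>\<^bsub>V\<^esub> w \<in> N"
        using u v l assms by (simp add: V.minus_eq V.minus_add V.smult_l_distr V.a_ac)
    qed (use u v l in auto)
    show "l (a \<odot>\<^bsub>V\<^esub> v) = a \<otimes>\<^bsub>K\<^esub> l v" if a: "a \<in> carrier K" for a
    proof (rule leq)
      have "a \<odot>\<^bsub>V\<^esub> (v \<ominus>\<^bsub>V\<^esub> l v \<odot>\<^bsub>V\<^esub> w) \<in> N"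
        using a v l NE(4) by simp
      then show "a \<odot>\<^bsub>V\<^esub> v \<ominus>\<^bsub>V\<^esub> (a \<otimes>\<^bsub>K\<^esub> l v) \<odot>\<^bsub>V\<^esub> w \<in> N"
        using a v l assms
        by (simp add: V.minus_eq V.smult_r_distr V.smult_r_minus V.smult_assoc1)
    qed (use a v l in auto)
  qed
  moreover have "l w = \<one>\<^bsub>K\<^esub>"
    using assms zN by (intro leq) (auto simp: V.minus_eq V.r_neg)
  ultimately show thesis
    using that by blast
qed


lemma is_linear_inv_into:
  assumes "is_linear K V W f" "bij_betw f (carrier V) (carrier W)" "module K V" "module K W"
  shows "is_linear K W V (inv_into (carrier V) f)"
proof -
  interpret V: module K V by fact
  interpret W: module K W by fact
  let ?g = "inv_into (carrier V) f"
  have g: "?g w \<in> carrier V" "f (?g w) = w" if "w \<in> carrier W" for w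
    using that assms(2) by (auto simp: bij_betw_def inv_into_into f_inv_into_f)
  have gf: "?g (f v) = v" if "v \<in> carrier V" for v
    using that assms(2) by (simp add: bij_betw_inv_into_left)
  have "?g (w \<oplus>\<^bsub>W\<^esub> w') = ?g w \<oplus>\<^bsub>V\<^esub> ?g w'" if "w \<in> carrier W" "w' \<in> carrier W" for w w'
    using that g gf[of "?g w \<oplus>\<^bsub>V\<^esub> ?g w'"] is_linear_add[OF assms(1), of "?g w" "?g w'"] by simp
  moreover have "?g (a \<odot>\<^bsub>W\<^esub> w) = a \<odot>\<^bsub>V\<^esub> ?g w" if "a \<in> carrier K" "w \<in> carrier W" for a w
    using that g gf[of "a \<odot>\<^bsub>V\<^esub> ?g w"] is_linear_smult[OF assms(1), of a "?g w"] by simp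
  ultimately show ?thesis
    using g by (auto simp: is_linear_def)
qed

section \<open>Linear categories\<close>

lemma
  assumes "category C"
  shows Ident_closed: "x \<in> Obj C \<Longrightarrow> Ident C x \<in> Arr C x x"
    and Comp_closed: "x \<in> Obj C \<Longrightarrow> y \<in> Obj C \<Longrightarrow> z \<in> Obj C \<Longrightarrow>
      f \<in> Arr C x y \<Longrightarrow> g \<in> Arr C y z \<Longrightarrow> Comp C x y z g f \<in> Arr C x z"
    and Comp_Ident_right: "x \<in> Obj C \<Longrightarrow> y \<in> Obj C \<Longrightarrow> f \<in> Arr C x y \<Longrightarrow>
      Comp C x x y f (Ident C x) = f"
    and Comp_Ident_left: "x \<in> Obj C \<Longrightarrow> y \<in> Obj C \<Longrightarrow> f \<in> Arr C x y \<Longrightarrow>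
      Comp C x y y (Ident C y) f = f"
    and Comp_assoc: "w \<in> Obj C \<Longrightarrow> x \<in> Obj C \<Longrightarrow> y \<in> Obj C \<Longrightarrow> z \<in> Obj C \<Longrightarrow>
      f \<in> Arr C w x \<Longrightarrow> g \<in> Arr C x y \<Longrightarrow> h \<in> Arr C y z \<Longrightarrow>
      Comp C w x z (Comp C x y z h g) f = Comp C w y z h (Comp C w x y g f)"
  using assms by (auto simp: category_def)

lemmas category_simps =
  Ident_closed Comp_closed Comp_Ident_right Comp_Ident_left Comp_assoc

lemma
  assumes "is_functor C D F"
  shows OMap_closed: "x \<in> Obj C \<Longrightarrow> OMap F x \<in> Obj D"
    and AMap_closed: "x \<in> Obj C \<Longrightarrow> y \<in> Obj C \<Longrightarrow> f \<in> Arr C x y \<Longrightarrow>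
      AMap F x y f \<in> Arr D (OMap F x) (OMap F y)"
    and AMap_Ident: "x \<in> Obj C \<Longrightarrow> AMap F x x (Ident C x) = Ident D (OMap F x)"
    and AMap_Comp: "x \<in> Obj C \<Longrightarrow> y \<in> Obj C \<Longrightarrow> z \<in> Obj C \<Longrightarrow>
      f \<in> Arr C x y \<Longrightarrow> g \<in> Arr C y z \<Longrightarrow>
      AMap F x z (Comp C x y z g f) =
      Comp D (OMap F x) (OMap F y) (OMap F z) (AMap F y z g) (AMap F x y f)"
  using assms by (auto simp: is_functor_def)

lemmas functor_simps = OMap_closed AMap_closed AMap_Ident AMap_Comp

lemma
  assumes "linear_category K C"
  shows linear_category_category: "category C"
    and module_HomSp: "x \<in> Obj C \<Longrightarrow> y \<in> Obj C \<Longrightarrow> module K (HomSp C x y)"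
    and carrier_HomSp: "x \<in> Obj C \<Longrightarrow> y \<in> Obj C \<Longrightarrow> carrier (HomSp C x y) = Arr C x y"
    and is_linear_precomp: "x \<in> Obj C \<Longrightarrow> y \<in> Obj C \<Longrightarrow> z \<in> Obj C \<Longrightarrow> f \<in> Arr C x y \<Longrightarrow>
      is_linear K (HomSp C y z) (HomSp C x z) (\<lambda>g. Comp C x y z g f)"
    and is_linear_postcomp: "x \<in> Obj C \<Longrightarrow> y \<in> Obj C \<Longrightarrow> z \<in> Obj C \<Longrightarrow> g \<in> Arr C y z \<Longrightarrow>
      is_linear K (HomSp C x y) (HomSp C x z) (\<lambda>f. Comp C x y z g f)"
  using assms by (auto simp: linear_category_def)

lemma bij_betw_precomp:
  assumes C: "category C" and iso: "iso_arr C x y t" and ob: "x \<in> Obj C" "y \<in> Obj C" "z \<in> Obj C"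
  shows "bij_betw (\<lambda>h. Comp C x y z h t) (Arr C y z) (Arr C x z)"
proof -
  obtain s where st: "t \<in> Arr C x y" "s \<in> Arr C y x"
      "Comp C x y x s t = Ident C x" "Comp C y x y t s = Ident C y"
    using iso by (auto simp: iso_arr_def)
  show ?thesis
    by (rule bij_betw_byWitness[where f' = "\<lambda>h. Comp C y x z h s"])
       (use ob st in \<open>auto simp: category_simps[OF C]\<close>)
qed

lemma is_copower_iso:
  assumes C: "linear_category K C" and "module K V" "x \<in> Obj C" "q \<in> Obj C"
    and cp: "is_copower K C x V p \<iota>" and iso: "iso_arr C p q t"
  shows "is_copower K C x V q (\<lambda>v. Comp C x p q t (\<iota> v))"
proof -
  note cat = linear_category_category[OF C]
  have p: "p \<in> Obj C" and lin: "is_linear K V (HomSp C x p) \<iota>"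
    using cp by (auto simp: is_copower_def)
  have t: "t \<in> Arr C p q"
    using iso by (simp add: iso_arr_def)
  have \<iota>: "\<iota> v \<in> Arr C x p" if "v \<in> carrier V" for v
    using is_linear_closed[OF lin that] assms p by (simp add: carrier_HomSp)
  have "bij_betw (\<lambda>h. \<lambda>v\<in>carrier V. Comp C x q y h (Comp C x p q t (\<iota> v)))
      (Arr C q y) (lin_maps K V (HomSp C x y))" if y: "y \<in> Obj C" for y
  proof -
    have "bij_betw ((\<lambda>h. \<lambda>v\<in>carrier V. Comp C x p y h (\<iota> v)) \<circ> (\<lambda>h. Comp C p q y h t))
        (Arr C q y) (lin_maps K V (HomSp C x y))"
      using cp y p assms
      by (intro bij_betw_trans[OF bij_betw_precomp[OF cat iso]]) (auto simp: is_copower_def)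
    then show ?thesis
      by (rule bij_betw_cong[THEN iffD1, rotated])
         (use assms y p t \<iota> in \<open>auto simp: category_simps[OF cat] intro!: restrict_ext\<close>)
  qed
  then show ?thesis
    using assms p t is_linear_compose[OF lin is_linear_postcomp[OF C]]
    by (simp add: is_copower_def)
qed

lemma Vect_simps [simp]:
  "V \<in> Obj (Vect K :: (('k, 'u) module, 'u \<Rightarrow> 'u, 'k) lin_cat) \<longleftrightarrow>
     module K V \<and> small TYPE('u) (carrier V)"
  "Arr (Vect K) = lin_maps K"
  "Comp (Vect K) U V W g f = compose (carrier U) g f"
  "Ident (Vect K) V = (\<lambda>v\<in>carrier V. v)"
  "HomSp (Vect K) = lin_maps_space K"
  by (simp_all add: Vect_def)

lemma compose_in_lin_maps:
  assumes "f \<in> lin_maps K U V" "g \<in> lin_maps K V W" "module K U"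
  shows "compose (carrier U) g f \<in> lin_maps K U W"
  using assms unfolding compose_def
  by (intro restrict_in_lin_maps is_linear_compose[of K U V f W g] lin_maps_linear)

lemma linear_category_Vect:
  "linear_category K (Vect K :: (('k, 'u) module, 'u \<Rightarrow> 'u, 'k) lin_cat)" (is "linear_category K ?D")
proof -
  have "category ?D"
    unfolding category_def
  proof (intro conjI ballI)
    fix V assume "V \<in> Obj ?D"
    then show "Ident ?D V \<in> Arr ?D V V"
      by (auto intro!: restrict_in_lin_maps simp: is_linear_def)
  next
    fix U V W f g
    assume "U \<in> Obj ?D" "V \<in> Obj ?D" "W \<in> Obj ?D" "f \<in> Arr ?D U V" "g \<in> Arr ?D V W"
    then show "Comp ?D U V W g f \<in> Arr ?D U W"
      by (simp add: compose_in_lin_maps)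
  next
    fix U V f assume "U \<in> Obj ?D" "V \<in> Obj ?D" and f: "f \<in> Arr ?D U V"
    then have "f v \<in> carrier V" if "v \<in> carrier U" for v
      using that by (simp add: is_linear_closed[OF lin_maps_linear])
    then show "Comp ?D U U V f (Ident ?D U) = f" "Comp ?D U V V (Ident ?D V) f = f"
      using lin_maps_extensional[of f K U V] f
      by (auto simp: compose_def extensional_def fun_eq_iff)
  next
    fix T U V W f g h
    assume "T \<in> Obj ?D" and f: "f \<in> Arr ?D T U"
    then have "f v \<in> carrier U" if "v \<in> carrier T" for v
      using that by (simp add: is_linear_closed[OF lin_maps_linear])
    then show "Comp ?D T U W (Comp ?D U V W h g) f = Comp ?D T V W h (Comp ?D T U V g f)"
      by (auto simp: compose_def fun_eq_iff)
  qed
  moreover have "is_linear K (HomSp ?D V W) (HomSp ?D U W) (\<lambda>g. Comp ?D U V W g f)"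
    if "module K U" "module K V" "module K W" and f: "f \<in> lin_maps K U V" for U V W f
  proof -
    have "f v \<in> carrier V" if "v \<in> carrier U" for v
      using f that by (simp add: is_linear_closed[OF lin_maps_linear])
    then show ?thesis
      using that compose_in_lin_maps[OF f]
      by (auto simp: is_linear_def lin_maps_space_def compose_def intro!: restrict_ext)
  qed
  moreover have "is_linear K (HomSp ?D U V) (HomSp ?D U W) (\<lambda>f. Comp ?D U V W g f)"
    if "module K U" "module K V" "module K W" and g: "g \<in> lin_maps K V W" for U V W g
    using that compose_in_lin_maps[OF _ g] is_linear_closed[OF lin_maps_linear, of _ K U V]
    by (auto simp: is_linear_def lin_maps_space_def compose_def is_linear_add[OF lin_maps_linear[OF g]]
        is_linear_smult[OF lin_maps_linear[OF g]] intro!: restrict_ext)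
  ultimately show ?thesis
    by (auto simp: linear_category_def module_lin_maps_space)
       (auto simp: lin_maps_space_def)
qed

section \<open>Equivalences\<close>

definition fully_faithful ::
  "('o, 'a, 'm) cat_scheme \<Rightarrow> ('p, 'b, 'n) cat_scheme \<Rightarrow> ('o, 'a, 'p, 'b) ftr \<Rightarrow> bool" where
  "fully_faithful C D F \<longleftrightarrow> (\<forall>x\<in>Obj C. \<forall>y\<in>Obj C.
     bij_betw (AMap F x y) (Arr C x y) (Arr D (OMap F x) (OMap F y)))"

definition essentially_surjective ::
  "('o, 'a, 'm) cat_scheme \<Rightarrow> ('p, 'b, 'n) cat_scheme \<Rightarrow> ('o, 'a, 'p, 'b) ftr \<Rightarrow> bool" where
  "essentially_surjective C D F \<longleftrightarrow> (\<forall>d\<in>Obj D. \<exists>c\<in>Obj C. \<exists>e. iso_arr D (OMap F c) d e)"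

lemma two_module_equivalentI:
  fixes C :: "('o, 'a, 'k) lin_cat" and D :: "('p, 'b, 'k) lin_cat"
  assumes C: "linear_category K C" and D: "linear_category K D"
    and F: "F \<in> two_module_hom K C D"
    and ff: "fully_faithful C D F" and ess: "essentially_surjective C D F"
  shows "two_module_equivalent K C D"
proof -
  have linF: "linear_functor K C D F" and funF: "is_functor C D F"
    using F by (auto simp: two_module_hom_def linear_functor_def)
  note [simp] = category_simps[OF linear_category_category[OF C]]
    category_simps[OF linear_category_category[OF D]] functor_simps[OF funF]
  have "\<exists>g e e'. g \<in> Obj C \<and> e \<in> Arr D (OMap F g) d \<and> e' \<in> Arr D d (OMap F g) \<and>
      Comp D (OMap F g) d (OMap F g) e' e = Ident D (OMap F g) \<and>
      Comp D d (OMap F g) d e e' = Ident D d" if "d \<in> Obj D" for d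
    using ess that by (auto simp: essentially_surjective_def iso_arr_def) blast
  then obtain g e e' where [simp]: "\<And>d. d \<in> Obj D \<Longrightarrow> g d \<in> Obj C"
      "\<And>d. d \<in> Obj D \<Longrightarrow> e d \<in> Arr D (OMap F (g d)) d"
      "\<And>d. d \<in> Obj D \<Longrightarrow> e' d \<in> Arr D d (OMap F (g d))"
      "\<And>d. d \<in> Obj D \<Longrightarrow> Comp D (OMap F (g d)) d (OMap F (g d)) (e' d) (e d) = Ident D (OMap F (g d))"
      "\<And>d. d \<in> Obj D \<Longrightarrow> Comp D d (OMap F (g d)) d (e d) (e' d) = Ident D d"
    by metis
  have [simp]: "Comp D c d (OMap F (g d)) (e' d) (Comp D c (OMap F (g d)) d (e d) h) = h"
    if "c \<in> Obj D" "d \<in> Obj D" "h \<in> Arr D c (OMap F (g d))" for c d h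
    using that by (simp flip: Comp_assoc[OF linear_category_category[OF D]])
  have [simp]: "Comp D c (OMap F (g d)) d (e d) (Comp D c d (OMap F (g d)) (e' d) h) = h"
    if "c \<in> Obj D" "d \<in> Obj D" "h \<in> Arr D c d" for c d h
    using that by (simp flip: Comp_assoc[OF linear_category_category[OF D]])
  have bij: "bij_betw (AMap F x y) (Arr C x y) (Arr D (OMap F x) (OMap F y))"
    if "x \<in> Obj C" "y \<in> Obj C" for x y
    using ff that by (simp add: fully_faithful_def)
  define P where "P x y = inv_into (Arr C x y) (AMap F x y)" for x y
  have [simp]: "P x y m \<in> Arr C x y" "AMap F x y (P x y m) = m"
    if "x \<in> Obj C" "y \<in> Obj C" "m \<in> Arr D (OMap F x) (OMap F y)" for x y m
    using bij that by (auto simp: P_def bij_betw_def inv_into_into f_inv_into_f)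
  have faithful: "u = v" if "AMap F x y u = AMap F x y v"
    "x \<in> Obj C" "y \<in> Obj C" "u \<in> Arr C x y" "v \<in> Arr C x y" for x y u v
    using bij that by (auto simp: bij_betw_def inj_on_def)
  define G where "G = \<lparr>OMap = g, AMap = \<lambda>d d' w. P (g d) (g d')
    (Comp D (OMap F (g d)) d' (OMap F (g d')) (e' d') (Comp D (OMap F (g d)) d d' w (e d)))\<rparr>"
  have [simp]: "OMap G = g" by (simp add: G_def)
  have AG [simp]: "AMap F (g d) (g d') (AMap G d d' w) =
      Comp D (OMap F (g d)) d' (OMap F (g d')) (e' d') (Comp D (OMap F (g d)) d d' w (e d))"
    "AMap G d d' w \<in> Arr C (g d) (g d')"
    if "d \<in> Obj D" "d' \<in> Obj D" "w \<in> Arr D d d'" for d d' w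
    using that by (simp_all add: G_def)
  have funG: "is_functor D C G"
    unfolding is_functor_def
  proof (intro conjI ballI)
    show "AMap G d d (Ident D d) = Ident C (OMap G d)" if "d \<in> Obj D" for d
      using that by (auto intro!: faithful[of "g d" "g d"])
    show "AMap G a c (Comp D a b c v u) =
        Comp C (OMap G a) (OMap G b) (OMap G c) (AMap G b c v) (AMap G a b u)"
      if "a \<in> Obj D" "b \<in> Obj D" "c \<in> Obj D" "u \<in> Arr D a b" "v \<in> Arr D b c" for a b c u v
      using that by (auto intro!: faithful[of "g a" "g c"])
  qed auto
  have "is_linear K (HomSp D d d') (HomSp C (g d) (g d')) (AMap G d d')"
    if d: "d \<in> Obj D" "d' \<in> Obj D" for d d'
  proof -
    have "is_linear K (HomSp D (OMap F (g d)) (OMap F (g d'))) (HomSp C (g d) (g d')) (P (g d) (g d'))"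
      using linF d bij[of "g d" "g d'"]
        is_linear_inv_into[of K "HomSp C (g d) (g d')" "HomSp D (OMap F (g d)) (OMap F (g d'))"]
      by (simp add: P_def linear_functor_def module_HomSp[OF C] module_HomSp[OF D]
          carrier_HomSp[OF C] carrier_HomSp[OF D])
    from is_linear_compose[OF is_linear_compose[OF
          is_linear_precomp[OF D, of "OMap F (g d)" d d' "e d"]
          is_linear_postcomp[OF D, of "OMap F (g d)" d' "OMap F (g d')" "e' d'"]] this]
    show ?thesis
      using d by (simp add: G_def)
  qed
  then have "linear_functor K D C G"
    by (simp add: linear_functor_def funG)
  moreover have "left_adjoint D C G"
    unfolding left_adjoint_def
  proof (intro conjI exI)
    let ?\<phi> = "\<lambda>d c h. Comp D d (OMap F (g d)) (OMap F c) (AMap F (g d) c h) (e' d)"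
    show "is_functor D C G" "is_functor C D F" by fact+
    show "\<forall>d\<in>Obj D. \<forall>c\<in>Obj C. bij_betw (?\<phi> d c) (Arr C (OMap G d) c) (Arr D d (OMap F c))"
    proof (intro ballI)
      fix d c assume dc: "d \<in> Obj D" "c \<in> Obj C"
      then have "iso_arr D d (OMap F (g d)) (e' d)"
        by (auto simp: iso_arr_def intro!: bexI[of _ "e d"])
      then have "bij_betw ((\<lambda>h. Comp D d (OMap F (g d)) (OMap F c) h (e' d)) \<circ> AMap F (g d) c)
          (Arr C (g d) c) (Arr D d (OMap F c))"
        using dc by (intro bij_betw_trans[OF bij]
            bij_betw_precomp[OF linear_category_category[OF D]]) auto
      then show "bij_betw (?\<phi> d c) (Arr C (OMap G d) c) (Arr D d (OMap F c))"
        by (simp add: comp_def)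
    qed
  qed auto
  ultimately have "G \<in> two_module_hom K D C"
    by (simp add: two_module_hom_def)
  moreover have "nat_isomorphic C C id_functor (comp_functor G F)"
    unfolding nat_isomorphic_def
  proof (intro exI conjI ballI)
    let ?\<eta> = "\<lambda>c. P c (g (OMap F c)) (e' (OMap F c))"
    show "iso_arr C (OMap id_functor c) (OMap (comp_functor G F) c) (?\<eta> c)" if c: "c \<in> Obj C" for c
    proof -
      let ?h = "g (OMap F c)" and ?\<theta> = "P (g (OMap F c)) c (e (OMap F c))"
      have "Comp C c ?h c ?\<theta> (?\<eta> c) = Ident C c"
        by (rule faithful[of c c]) (use c in simp_all)
      moreover have "Comp C ?h c ?h (?\<eta> c) ?\<theta> = Ident C ?h"
        by (rule faithful[of ?h ?h]) (use c in simp_all)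
      ultimately show ?thesis
        using c by (auto simp: iso_arr_def id_functor_def comp_functor_def intro!: bexI[of _ ?\<theta>])
    qed
    show "Comp C (OMap id_functor c) (OMap id_functor d) (OMap (comp_functor G F) d) (?\<eta> d)
        (AMap id_functor c d u) =
      Comp C (OMap id_functor c) (OMap (comp_functor G F) c) (OMap (comp_functor G F) d)
        (AMap (comp_functor G F) c d u) (?\<eta> c)"
      if "c \<in> Obj C" "d \<in> Obj C" "u \<in> Arr C c d" for c d u
      by (rule faithful[of c "g (OMap F d)"]) (use that in \<open>simp_all add: id_functor_def comp_functor_def\<close>)
  qed
  moreover have "nat_isomorphic D D (comp_functor F G) id_functor"
    unfolding nat_isomorphic_def
  proof (intro exI conjI ballI)
    show "iso_arr D (OMap (comp_functor F G) d) (OMap id_functor d) (e d)" if "d \<in> Obj D" for d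
      using that unfolding iso_arr_def
      by (auto simp: id_functor_def comp_functor_def intro!: bexI[of _ "e' d"])
  qed (auto simp: id_functor_def comp_functor_def)
  ultimately show ?thesis
    using F by (auto simp: two_module_equivalent_def)
qed

lemma left_adjoint_counit:
  assumes C: "category C" and D: "category D" and F: "left_adjoint C D F" and d: "d \<in> Obj D"
  obtains g \<epsilon> where "g \<in> Obj C" "\<epsilon> \<in> Arr D (OMap F g) d"
    "\<And>c. c \<in> Obj C \<Longrightarrow> bij_betw (\<lambda>u. Comp D (OMap F c) (OMap F g) d \<epsilon> (AMap F c g u))
       (Arr C c g) (Arr D (OMap F c) d)"
proof -
  have funF: "is_functor C D F"
    using F by (simp add: left_adjoint_def)
  obtain G \<phi> where funG: "is_functor D C G"
    and bij: "\<forall>c\<in>Obj C. \<forall>d\<in>Obj D.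
      bij_betw (\<phi> c d) (Arr D (OMap F c) d) (Arr C c (OMap G d))"
    and nat: "\<forall>c\<in>Obj C. \<forall>c'\<in>Obj C. \<forall>d\<in>Obj D. \<forall>d'\<in>Obj D.
      \<forall>u\<in>Arr C c' c. \<forall>h\<in>Arr D (OMap F c) d. \<forall>w\<in>Arr D d d'.
      \<phi> c' d' (Comp D (OMap F c') (OMap F c) d' (Comp D (OMap F c) d d' w h) (AMap F c' c u)) =
      Comp C c' c (OMap G d') (Comp C c (OMap G d) (OMap G d') (AMap G d d' w) (\<phi> c d h)) u"
    using F unfolding left_adjoint_def by blast
  note bij = bij[rule_format] and nat = nat[rule_format]
  note [simp] = category_simps[OF C] category_simps[OF D] functor_simps[OF funF]
    functor_simps[OF funG]
  define g where "g = OMap G d"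
  have g [simp]: "g \<in> Obj C"
    using d by (simp add: g_def)
  have "Ident C g \<in> \<phi> g d ` Arr D (OMap F g) d"
    using bij[OF g d] d by (simp add: bij_betw_def g_def)
  then obtain \<epsilon> where \<epsilon> [simp]: "\<epsilon> \<in> Arr D (OMap F g) d" "\<phi> g d \<epsilon> = Ident C g"
    by auto
  have "bij_betw (\<lambda>u. Comp D (OMap F c) (OMap F g) d \<epsilon> (AMap F c g u)) (Arr C c g) (Arr D (OMap F c) d)"
    if c: "c \<in> Obj C" for c
  proof -
    have 1: "\<phi> c d (Comp D (OMap F c) (OMap F g) d \<epsilon> (AMap F c g u)) = u" if "u \<in> Arr C c g" for u
      using nat[of g c d d u \<epsilon> "Ident D d"] that c d by (simp add: g_def[symmetric])
    have inj: "inj_on (\<phi> c d) (Arr D (OMap F c) d)"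
      and \<phi>: "\<phi> c d h \<in> Arr C c g" if "h \<in> Arr D (OMap F c) d" for h
      using bij[OF c d] that by (auto simp: bij_betw_def g_def)
    have 2: "Comp D (OMap F c) (OMap F g) d \<epsilon> (AMap F c g (\<phi> c d h)) = h"
      if h: "h \<in> Arr D (OMap F c) d" for h
      by (rule inj_onD[OF inj[OF h] 1[OF \<phi>[OF h]]]) (use h \<phi>[OF h] c d in simp_all)
    show ?thesis
      using 1 2 \<phi> c d by (intro bij_betw_byWitness[where f' = "\<phi> c d"]) auto
  qed
  then show thesis
    using that[of g \<epsilon>] by simp
qed


section \<open>Presenting every object as a copower of a single one\<close>

locale copower_presentation =
  fixes K :: "('k, 'r) ring_scheme"
    and C :: "('o, 'a, 'k) lin_cat"
    and x :: 'o
    and F :: "('o, 'a, ('k, 'u) module, 'u \<Rightarrow> 'u) ftr"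
    and \<sigma> :: "'o \<Rightarrow> 'u \<Rightarrow> 'a"
  assumes field: "field K"
    and linear: "linear_category K C"
    and nontrivial: "nontrivial C"
    and x [simp]: "x \<in> Obj C"
    and linear_F: "linear_functor K C (Vect K) F"
    and copower: "c \<in> Obj C \<Longrightarrow> is_copower K C x (OMap F c) c (\<sigma> c)"
    and natural: "c \<in> Obj C \<Longrightarrow> d \<in> Obj C \<Longrightarrow> u \<in> Arr C c d \<Longrightarrow> v \<in> carrier (OMap F c) \<Longrightarrow>
      Comp C x c d u (\<sigma> c v) = \<sigma> d (AMap F c d u v)"
begin

lemmas category = linear_category_category[OF linear]
lemmas [simp] = category_simps[OF category]
lemmas [simp] = carrier_HomSp[OF linear] module_HomSp[OF linear]

lemma functor_F: "is_functor C (Vect K) F"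
  using linear_F by (simp add: linear_functor_def)

lemma module_F [simp]: "c \<in> Obj C \<Longrightarrow> module K (OMap F c)"
  using OMap_closed[OF functor_F] by simp

lemma AMap_lin_maps [simp]:
  "c \<in> Obj C \<Longrightarrow> d \<in> Obj C \<Longrightarrow> u \<in> Arr C c d \<Longrightarrow> AMap F c d u \<in> lin_maps K (OMap F c) (OMap F d)"
  using AMap_closed[OF functor_F] by simp

lemma AMap_carrier [simp]:
  "c \<in> Obj C \<Longrightarrow> d \<in> Obj C \<Longrightarrow> u \<in> Arr C c d \<Longrightarrow> v \<in> carrier (OMap F c) \<Longrightarrow>
    AMap F c d u v \<in> carrier (OMap F d)"
  by (rule is_linear_closed[OF lin_maps_linear[OF AMap_lin_maps]])

lemma \<sigma>_linear: "c \<in> Obj C \<Longrightarrow> is_linear K (OMap F c) (HomSp C x c) (\<sigma> c)"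
  using copower by (simp add: is_copower_def)

lemma \<sigma>_closed [simp]: "c \<in> Obj C \<Longrightarrow> v \<in> carrier (OMap F c) \<Longrightarrow> \<sigma> c v \<in> Arr C x c"
  using is_linear_closed[OF \<sigma>_linear] by simp

lemma copower_eqI:
  assumes "c \<in> Obj C" "d \<in> Obj C" "h \<in> Arr C c d" "h' \<in> Arr C c d"
    and "\<And>v. v \<in> carrier (OMap F c) \<Longrightarrow> Comp C x c d h (\<sigma> c v) = Comp C x c d h' (\<sigma> c v)"
  shows "h = h'"
proof -
  have "inj_on (\<lambda>h. \<lambda>v\<in>carrier (OMap F c). Comp C x c d h (\<sigma> c v)) (Arr C c d)"
    using copower[OF assms(1)] assms(2) by (simp add: is_copower_def bij_betw_def)
  then show ?thesis
    by (rule inj_onD) (use assms in \<open>auto intro!: restrict_ext\<close>)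
qed

lemma copower_induced:
  assumes "c \<in> Obj C" "d \<in> Obj C" "is_linear K (OMap F c) (HomSp C x d) l"
  obtains h where "h \<in> Arr C c d"
    "\<And>v. v \<in> carrier (OMap F c) \<Longrightarrow> Comp C x c d h (\<sigma> c v) = l v"
proof -
  have "restrict l (carrier (OMap F c)) \<in>
      (\<lambda>h. \<lambda>v\<in>carrier (OMap F c). Comp C x c d h (\<sigma> c v)) ` Arr C c d"
    using copower[OF assms(1)] assms restrict_in_lin_maps[OF assms(3)]
    by (simp add: is_copower_def bij_betw_def)
  then obtain h where h: "h \<in> Arr C c d"
      "restrict l (carrier (OMap F c)) = (\<lambda>v\<in>carrier (OMap F c). Comp C x c d h (\<sigma> c v))"
    by auto
  have "Comp C x c d h (\<sigma> c v) = l v" if "v \<in> carrier (OMap F c)" for v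
    using fun_cong[OF h(2), of v] that by simp
  with h that show thesis by blast
qed

lemma Ident_x_nonzero: "Ident C x \<noteq> \<zero>\<^bsub>HomSp C x x\<^esub>"
proof
  assume zero: "Ident C x = \<zero>\<^bsub>HomSp C x x\<^esub>"
  have x_zero: "h = \<zero>\<^bsub>HomSp C x c\<^esub>" if "c \<in> Obj C" "h \<in> Arr C x c" for c h
  proof -
    have "h = Comp C x x c h (Ident C x)"
      using that by simp
    then show ?thesis
      using is_linear_zero[OF is_linear_postcomp[OF linear x x that]] that by (simp add: zero)
  qed
  have unique: "h = h'" if "c \<in> Obj C" "d \<in> Obj C" "h \<in> Arr C c d" "h' \<in> Arr C c d" for c d h h'
    using that
    by (intro copower_eqI[OF that] trans[OF x_zero[of d] x_zero[of d, symmetric]]) simp_all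
  have "\<exists>!h. h \<in> Arr C c d" if "c \<in> Obj C" "d \<in> Obj C" for c d
  proof -
    interpret module K "HomSp C c d" using that by simp
    have "\<zero>\<^bsub>HomSp C c d\<^esub> \<in> Arr C c d"
      using M.zero_closed that by simp
    then show ?thesis
      using unique that by blast
  qed
  then show False
    using nontrivial by (auto simp: nontrivial_def zero_object_def)
qed

lemma ex_retraction:
  assumes "c \<in> Obj C" "linear_form K (OMap F c) l"
  obtains h where "h \<in> Arr C c x"
    "\<And>v. v \<in> carrier (OMap F c) \<Longrightarrow> Comp C x c x h (\<sigma> c v) = l v \<odot>\<^bsub>HomSp C x x\<^esub> Ident C x"
  by (rule copower_induced[OF assms(1) x linear_form_smult[OF assms(2) module_HomSp[OF linear x x],
          of "Ident C x"]]) (use that in auto)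

lemma \<sigma>_inj:
  assumes c: "c \<in> Obj C" and vw: "v \<in> carrier (OMap F c)" "w \<in> carrier (OMap F c)" "\<sigma> c v = \<sigma> c w"
  shows "v = w"
proof (rule ccontr)
  assume "v \<noteq> w"
  interpret K: field K by (rule field)
  interpret V: module K "OMap F c" using c by simp
  interpret xx: module K "HomSp C x x" by simp
  let ?u = "v \<ominus>\<^bsub>OMap F c\<^esub> w"
  have "?u \<noteq> \<zero>\<^bsub>OMap F c\<^esub>"
    using \<open>v \<noteq> w\<close> vw V.M.eq_if_minus_eq_zero by blast
  then obtain l where l: "linear_form K (OMap F c) l" "l ?u = \<one>\<^bsub>K\<^esub>"
    using ex_linear_form[OF field V.module_axioms, of ?u] vw by auto
  have "l v = l (?u \<oplus>\<^bsub>OMap F c\<^esub> w)"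
    using vw by (simp add: V.minus_eq V.a_assoc V.l_neg)
  also have "\<dots> = \<one>\<^bsub>K\<^esub> \<oplus>\<^bsub>K\<^esub> l w"
    using l vw by (simp add: linear_form_def)
  finally have lv: "l v = \<one>\<^bsub>K\<^esub> \<oplus>\<^bsub>K\<^esub> l w" .
  have lw: "l w \<in> carrier K"
    using l vw by (auto simp: linear_form_def)
  obtain h where h: "h \<in> Arr C c x"
    "\<And>v. v \<in> carrier (OMap F c) \<Longrightarrow> Comp C x c x h (\<sigma> c v) = l v \<odot>\<^bsub>HomSp C x x\<^esub> Ident C x"
    using ex_retraction[OF c l(1)] by blast
  have id: "Ident C x \<in> carrier (HomSp C x x)"
    by simp
  have "l v \<odot>\<^bsub>HomSp C x x\<^esub> Ident C x = l w \<odot>\<^bsub>HomSp C x x\<^esub> Ident C x"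
    using h(2)[of v] h(2)[of w] vw by simp
  then have "Ident C x \<oplus>\<^bsub>HomSp C x x\<^esub> l w \<odot>\<^bsub>HomSp C x x\<^esub> Ident C x = l w \<odot>\<^bsub>HomSp C x x\<^esub> Ident C x"
    using lv lw id xx.smult_l_distr[OF K.one_closed lw id] xx.smult_one[OF id] by simp
  then show False
    using Ident_x_nonzero id lw xx.smult_closed[OF lw id] xx.add.r_cancel_one by blast
qed

lemma fully_faithful: "fully_faithful C (Vect K) F"
  unfolding fully_faithful_def
proof (intro ballI)
  fix c d assume c [simp]: "c \<in> Obj C" and d [simp]: "d \<in> Obj C"
  have "u = u'" if u: "u \<in> Arr C c d" "u' \<in> Arr C c d" "AMap F c d u = AMap F c d u'" for u u'
    using u by (intro copower_eqI[of c d u u']) (simp_all add: natural)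
  moreover have "m \<in> AMap F c d ` Arr C c d" if m: "m \<in> lin_maps K (OMap F c) (OMap F d)" for m
  proof -
    obtain u where u: "u \<in> Arr C c d"
      "\<And>v. v \<in> carrier (OMap F c) \<Longrightarrow> Comp C x c d u (\<sigma> c v) = \<sigma> d (m v)"
      using copower_induced[OF c d is_linear_compose[OF lin_maps_linear[OF m] \<sigma>_linear[OF d]]]
      by blast
    have "AMap F c d u = m"
    proof (rule lin_maps_eqI[OF AMap_lin_maps[OF c d u(1)] m])
      fix v assume v: "v \<in> carrier (OMap F c)"
      then have "\<sigma> d (AMap F c d u v) = \<sigma> d (m v)"
        using u natural[OF c d u(1) v] by simp
      then show "AMap F c d u v = m v"
        using u v is_linear_closed[OF lin_maps_linear[OF m] v] by (intro \<sigma>_inj[OF d]) auto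
    qed
    then show ?thesis
      using u by blast
  qed
  ultimately show "bij_betw (AMap F c d) (Arr C c d) (Arr (Vect K) (OMap F c) (OMap F d))"
    by (auto simp: bij_betw_def inj_on_def)
qed

lemma full:
  assumes "c \<in> Obj C" "d \<in> Obj C" "is_linear K (OMap F c) (OMap F d) m"
  obtains u where "u \<in> Arr C c d" "\<And>v. v \<in> carrier (OMap F c) \<Longrightarrow> AMap F c d u v = m v"
proof -
  have "restrict m (carrier (OMap F c)) \<in> AMap F c d ` Arr C c d"
    using fully_faithful assms restrict_in_lin_maps[OF assms(3)]
    by (simp add: fully_faithful_def bij_betw_def)
  then obtain u where "u \<in> Arr C c d" "AMap F c d u = restrict m (carrier (OMap F c))"
    by auto
  then show thesis
    using that[of u] by simp
qed

lemma ex_nonzero: "\<exists>v\<in>carrier (OMap F x). v \<noteq> \<zero>\<^bsub>OMap F x\<^esub>"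
proof (rule ccontr)
  assume "\<not> ?thesis"
  then have zero: "v = \<zero>\<^bsub>OMap F x\<^esub>" if "v \<in> carrier (OMap F x)" for v
    using that by blast
  interpret V: module K "OMap F x" by simp
  interpret xx: module K "HomSp C x x" by simp
  have z: "\<zero>\<^bsub>HomSp C x x\<^esub> \<in> Arr C x x"
    using xx.M.zero_closed by simp
  have 0: "Comp C x x x h (\<sigma> x \<zero>\<^bsub>OMap F x\<^esub>) = \<sigma> x \<zero>\<^bsub>OMap F x\<^esub>" if "h \<in> Arr C x x" for h
    using that zero[of "AMap F x x h \<zero>\<^bsub>OMap F x\<^esub>"] by (simp add: natural)
  have "Ident C x = \<zero>\<^bsub>HomSp C x x\<^esub>"
    by (rule copower_eqI[OF x x]) (use z 0 zero in \<open>metis Ident_closed category x\<close>)+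
  then show False
    using Ident_x_nonzero by contradiction
qed

text \<open>
  Precomposition with \<open>e\<close> acts on the copower \<open>x\<close> of \<open>x\<close> by \<open>OMap F x\<close> as a central arrow \<open>e'\<close>,
  and cancelling a split monomorphism \<open>\<sigma> x v\<close> shows \<open>e = e'\<close>.
\<close>

lemma endomorphisms_commute:
  assumes e: "e \<in> Arr C x x" and k: "k \<in> Arr C x x"
  shows "Comp C x x x e k = Comp C x x x k e"
proof -
  obtain e' where e': "e' \<in> Arr C x x"
    "\<And>v. v \<in> carrier (OMap F x) \<Longrightarrow> Comp C x x x e' (\<sigma> x v) = Comp C x x x (\<sigma> x v) e"
    using copower_induced[OF x x is_linear_compose[OF \<sigma>_linear is_linear_precomp[OF linear x x x e]]]
    by auto
  have central: "Comp C x x x e' k = Comp C x x x k e'" if k: "k \<in> Arr C x x" for k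
  proof (rule copower_eqI[OF x x])
    fix v assume v: "v \<in> carrier (OMap F x)"
    have "Comp C x x x (Comp C x x x e' k) (\<sigma> x v) = Comp C x x x e' (\<sigma> x (AMap F x x k v))"
      using k v e' by (simp add: natural del: e'(2))
    also have "\<dots> = Comp C x x x (\<sigma> x (AMap F x x k v)) e"
      using k v e'(2) by simp
    also have "\<dots> = Comp C x x x k (Comp C x x x (\<sigma> x v) e)"
      using k v e by (simp flip: natural)
    also have "\<dots> = Comp C x x x (Comp C x x x k e') (\<sigma> x v)"
      using k v e' by simp
    finally show "Comp C x x x (Comp C x x x e' k) (\<sigma> x v) = Comp C x x x (Comp C x x x k e') (\<sigma> x v)" .
  qed (use k e' in auto)
  obtain v where v: "v \<in> carrier (OMap F x)" "v \<noteq> \<zero>\<^bsub>OMap F x\<^esub>"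
    using ex_nonzero by blast
  obtain l where l: "linear_form K (OMap F x) l" "l v = \<one>\<^bsub>K\<^esub>"
    using ex_linear_form[OF field module_F[OF x] v] by blast
  obtain h where h: "h \<in> Arr C x x"
    "\<And>v. v \<in> carrier (OMap F x) \<Longrightarrow> Comp C x x x h (\<sigma> x v) = l v \<odot>\<^bsub>HomSp C x x\<^esub> Ident C x"
    using ex_retraction[OF x l(1)] by blast
  have "Comp C x x x h (\<sigma> x v) = Ident C x"
    using h(2)[OF v(1)] l(2) module.smult_one[OF module_HomSp[OF linear x x], of "Ident C x"] by simp
  have cancel: "Comp C x x x h (Comp C x x x (\<sigma> x v) k) = k" if "k \<in> Arr C x x" for k
    using that h(1) v by (simp add: \<open>Comp C x x x h (\<sigma> x v) = Ident C x\<close> flip: Comp_assoc[OF category])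
  have "Comp C x x x (\<sigma> x v) e = Comp C x x x (\<sigma> x v) e'"
    using central[of "\<sigma> x v"] e'(2)[of v] v by simp
  then have "e = e'"
    by (metis cancel e e'(1))
  then show ?thesis
    using central[OF k] by simp
qed

lemma one_dimensional:
  obtains v0 l where "v0 \<in> carrier (OMap F x)" "linear_form K (OMap F x) l" "l v0 = \<one>\<^bsub>K\<^esub>"
    "\<And>w. w \<in> carrier (OMap F x) \<Longrightarrow> l w \<odot>\<^bsub>OMap F x\<^esub> v0 = w"
proof -
  let ?V = "OMap F x"
  interpret V: module K ?V by simp
  obtain v0 where v0: "v0 \<in> carrier ?V" "v0 \<noteq> \<zero>\<^bsub>?V\<^esub>"
    using ex_nonzero by blast
  obtain l where l: "linear_form K ?V l" "l v0 = \<one>\<^bsub>K\<^esub>"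
    using ex_linear_form[OF field module_F[OF x] v0] by blast
  have "l w \<odot>\<^bsub>?V\<^esub> v0 = w" if w: "w \<in> carrier ?V" for w
  proof -
    obtain e where e: "e \<in> Arr C x x" "\<And>v. v \<in> carrier ?V \<Longrightarrow> AMap F x x e v = l v \<odot>\<^bsub>?V\<^esub> v0"
      using full[OF x x linear_form_smult[OF l(1) V.module_axioms v0(1)]] by blast
    obtain k where k: "k \<in> Arr C x x" "\<And>v. v \<in> carrier ?V \<Longrightarrow> AMap F x x k v = l v \<odot>\<^bsub>?V\<^esub> w"
      using full[OF x x linear_form_smult[OF l(1) V.module_axioms w]] by blast
    have "AMap F x x (Comp C x x x e k) v0 = AMap F x x (Comp C x x x k e) v0"
      using endomorphisms_commute[OF e(1) k(1)] by simp
    then have "AMap F x x e (AMap F x x k v0) = AMap F x x k (AMap F x x e v0)"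
      using e(1) k(1) v0 by (simp add: AMap_Comp[OF functor_F] compose_eq)
    then show ?thesis
      using e(2) k(2) v0 w l by simp
  qed
  then show thesis
    using that v0 l by blast
qed

lemma essentially_surjective:
  assumes F: "left_adjoint C (Vect K) F"
  shows "essentially_surjective C (Vect K) F"
  unfolding essentially_surjective_def
proof
  fix W assume W: "W \<in> Obj (Vect K :: (('k, 'u) module, 'u \<Rightarrow> 'u, 'k) lin_cat)"
  then have mW: "module K W" by simp
  obtain g \<epsilon> where g: "g \<in> Obj C" and \<epsilon>: "\<epsilon> \<in> lin_maps K (OMap F g) W"
    and bij: "\<And>c. c \<in> Obj C \<Longrightarrow>
      bij_betw (\<lambda>u. compose (carrier (OMap F c)) \<epsilon> (AMap F c g u)) (Arr C c g) (lin_maps K (OMap F c) W)"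
    by (rule left_adjoint_counit[OF category linear_category_category[OF linear_category_Vect] F W])
       simp
  obtain v0 l where v0: "v0 \<in> carrier (OMap F x)" and l: "linear_form K (OMap F x) l" "l v0 = \<one>\<^bsub>K\<^esub>"
    "\<And>w. w \<in> carrier (OMap F x) \<Longrightarrow> l w \<odot>\<^bsub>OMap F x\<^esub> v0 = w"
    using one_dimensional by blast
  have lin_\<epsilon>: "is_linear K (OMap F g) W \<epsilon>"
    using \<epsilon> by (rule lin_maps_linear)
  have "inj_on \<epsilon> (carrier (OMap F g))"
  proof (rule inj_onI)
    fix y z assume y: "y \<in> carrier (OMap F g)" and z: "z \<in> carrier (OMap F g)" and eq: "\<epsilon> y = \<epsilon> z"
    note lf = linear_form_smult[OF l(1) module_F[OF g]]
    have lc: "l v \<in> carrier K" if "v \<in> carrier (OMap F x)" for v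
      using l(1) that by (auto simp: linear_form_def)
    obtain u where u: "u \<in> Arr C x g"
      "\<And>v. v \<in> carrier (OMap F x) \<Longrightarrow> AMap F x g u v = l v \<odot>\<^bsub>OMap F g\<^esub> y"
      using full[OF x g lf[OF y]] by blast
    obtain u' where u': "u' \<in> Arr C x g"
      "\<And>v. v \<in> carrier (OMap F x) \<Longrightarrow> AMap F x g u' v = l v \<odot>\<^bsub>OMap F g\<^esub> z"
      using full[OF x g lf[OF z]] by blast
    have "compose (carrier (OMap F x)) \<epsilon> (AMap F x g u) = compose (carrier (OMap F x)) \<epsilon> (AMap F x g u')"
      using u(2) u'(2) y z eq lc is_linear_smult[OF lin_\<epsilon>]
      by (auto simp: compose_def intro!: restrict_ext)
    then have "u = u'"
      using bij[OF x] u(1) u'(1) by (auto simp: bij_betw_def inj_on_def)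
    then have "\<one>\<^bsub>K\<^esub> \<odot>\<^bsub>OMap F g\<^esub> y = \<one>\<^bsub>K\<^esub> \<odot>\<^bsub>OMap F g\<^esub> z"
      using u(2)[OF v0] u'(2)[OF v0] l(2) by simp
    then show "y = z"
      using y z module.smult_one[OF module_F[OF g]] by simp
  qed
  moreover have "w \<in> \<epsilon> ` carrier (OMap F g)" if w: "w \<in> carrier W" for w
  proof -
    have "(\<lambda>v\<in>carrier (OMap F x). l v \<odot>\<^bsub>W\<^esub> w) \<in> lin_maps K (OMap F x) W"
      by (rule restrict_in_lin_maps[OF linear_form_smult[OF l(1) mW w] module_F[OF x]])
    then obtain u where u: "u \<in> Arr C x g"
      "compose (carrier (OMap F x)) \<epsilon> (AMap F x g u) = (\<lambda>v\<in>carrier (OMap F x). l v \<odot>\<^bsub>W\<^esub> w)"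
      using bij[OF x] unfolding bij_betw_def by (metis (no_types, lifting) imageE)
    have "\<epsilon> (AMap F x g u v0) = w"
      using fun_cong[OF u(2), of v0] v0 l(2) w module.smult_one[OF mW] by (simp add: compose_eq)
    then show ?thesis
      using u(1) v0 g by force
  qed
  ultimately have b: "bij_betw \<epsilon> (carrier (OMap F g)) (carrier W)"
    using is_linear_closed[OF lin_\<epsilon>] by (auto simp: bij_betw_def)
  let ?i = "restrict (inv_into (carrier (OMap F g)) \<epsilon>) (carrier W)"
  have "?i \<in> lin_maps K W (OMap F g)"
    by (intro restrict_in_lin_maps is_linear_inv_into lin_\<epsilon> b mW module_F g)
  moreover have "compose (carrier (OMap F g)) ?i \<epsilon> = (\<lambda>v\<in>carrier (OMap F g). v)"
    using b by (rule compose_inv_into_id)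
  moreover have "compose (carrier W) \<epsilon> ?i = (\<lambda>w\<in>carrier W. w)"
    using b by (auto simp: compose_def bij_betw_def f_inv_into_f intro!: restrict_ext)
  ultimately have "iso_arr (Vect K) (OMap F g) W \<epsilon>"
    using \<epsilon> by (auto simp: iso_arr_def)
  then show "\<exists>c\<in>Obj C. \<exists>e. iso_arr (Vect K) (OMap F c) W e"
    using g by blast
qed

end

theorem corollary0p3:
  fixes K :: "('k, 'r) ring_scheme"
    and C :: "('o, 'a, 'k) lin_cat"
    and x :: 'o
    and f :: "('o, 'a, ('k, 'u) module, 'u \<Rightarrow> 'u) ftr"
    and T :: "('o, 'a, 'o, 'a) ftr"
    and \<iota> :: "'o \<Rightarrow> 'u \<Rightarrow> 'a"
  assumes "grothendieck_universe TYPE('u)"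
    and "field K"
    and "two_module TYPE('u) K C"
    and "nontrivial C"
    and "x \<in> Obj C"
    and "f \<in> dual K C"
    and "is_tensor_functor K C x f T \<iota>"
    and "nat_isomorphic C C id_functor T"
  shows "two_module_equivalent K C (Vect K :: (('k, 'u) module, 'u \<Rightarrow> 'u, 'k) lin_cat)"
proof -
  have C: "linear_category K C"
    using assms(3) by (simp add: two_module_def)
  note cat = linear_category_category[OF C]
  have f: "f \<in> two_module_hom K C (Vect K)"
    using assms(6) by (simp add: dual_def)
  then have lin_f: "linear_functor K C (Vect K) f" and adj_f: "left_adjoint C (Vect K) f"
    by (auto simp: two_module_hom_def)
  have fun_f: "is_functor C (Vect K) f"
    using lin_f by (simp add: linear_functor_def)
  have fun_T: "is_functor C C T"
    and cp: "\<And>c. c \<in> Obj C \<Longrightarrow> is_copower K C x (OMap f c) (OMap T c) (\<iota> c)"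
    and T: "\<And>c d u v. c \<in> Obj C \<Longrightarrow> d \<in> Obj C \<Longrightarrow> u \<in> Arr C c d \<Longrightarrow> v \<in> carrier (OMap f c) \<Longrightarrow>
      Comp C x (OMap T c) (OMap T d) (AMap T c d u) (\<iota> c v) = \<iota> d (AMap f c d u v)"
    using assms(7) by (auto simp: is_tensor_functor_def)
  note [simp] = category_simps[OF cat] functor_simps[OF fun_T] \<open>x \<in> Obj C\<close>
  obtain \<eta> where iso: "\<forall>c\<in>Obj C. iso_arr C c (OMap T c) (\<eta> c)"
    and nat: "\<forall>c\<in>Obj C. \<forall>d\<in>Obj C. \<forall>u\<in>Arr C c d.
      Comp C c d (OMap T d) (\<eta> d) u = Comp C c (OMap T c) (OMap T d) (AMap T c d u) (\<eta> c)"
    using assms(8) by (auto simp: nat_isomorphic_def id_functor_def)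
  note iso = iso[rule_format] and nat = nat[rule_format]
  have "\<exists>t. t \<in> Arr C (OMap T c) c \<and> Comp C c (OMap T c) c t (\<eta> c) = Ident C c \<and>
      Comp C (OMap T c) c (OMap T c) (\<eta> c) t = Ident C (OMap T c)" if "c \<in> Obj C" for c
    using iso[OF that] by (auto simp: iso_arr_def)
  then obtain \<theta> where \<theta> [simp]: "\<And>c. c \<in> Obj C \<Longrightarrow> \<theta> c \<in> Arr C (OMap T c) c"
    "\<And>c. c \<in> Obj C \<Longrightarrow> Comp C c (OMap T c) c (\<theta> c) (\<eta> c) = Ident C c"
    "\<And>c. c \<in> Obj C \<Longrightarrow> Comp C (OMap T c) c (OMap T c) (\<eta> c) (\<theta> c) = Ident C (OMap T c)"
    by metis
  have \<eta> [simp]: "\<eta> c \<in> Arr C c (OMap T c)" if "c \<in> Obj C" for c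
    using iso[OF that] by (simp add: iso_arr_def)
  have \<theta>_nat: "Comp C (OMap T c) c d u (\<theta> c) = Comp C (OMap T c) (OMap T d) d (\<theta> d) (AMap T c d u)"
    if "c \<in> Obj C" "d \<in> Obj C" "u \<in> Arr C c d" for c d u
  proof -
    have "Comp C (OMap T c) c d u (\<theta> c) =
        Comp C (OMap T c) c d (Comp C c (OMap T d) d (\<theta> d) (Comp C c d (OMap T d) (\<eta> d) u)) (\<theta> c)"
      using that by (simp flip: Comp_assoc[OF cat])
    also have "\<dots> = Comp C (OMap T c) (OMap T d) d (\<theta> d) (AMap T c d u)"
      using that by (simp add: nat[OF that])
    finally show ?thesis .
  qed
  have \<iota>: "\<iota> c v \<in> Arr C x (OMap T c)" if "c \<in> Obj C" "v \<in> carrier (OMap f c)" for c v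
    using cp[OF that(1)] that is_linear_closed[of K "OMap f c" "HomSp C x (OMap T c)" "\<iota> c" v]
    by (simp add: is_copower_def carrier_HomSp[OF C])
  interpret copower_presentation K C x f "\<lambda>c v. Comp C x (OMap T c) c (\<theta> c) (\<iota> c v)"
  proof (rule copower_presentation.intro)
    show "is_copower K C x (OMap f c) c (\<lambda>v. Comp C x (OMap T c) c (\<theta> c) (\<iota> c v))" if c: "c \<in> Obj C" for c
    proof (rule is_copower_iso[OF C _ _ _ cp])
      show "iso_arr C (OMap T c) c (\<theta> c)"
        using c by (auto simp: iso_arr_def intro!: bexI[of _ "\<eta> c"])
    qed (use c OMap_closed[OF fun_f c] in auto)
    show "Comp C x c d u (Comp C x (OMap T c) c (\<theta> c) (\<iota> c v)) =
        Comp C x (OMap T d) d (\<theta> d) (\<iota> d (AMap f c d u v))"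
      if "c \<in> Obj C" "d \<in> Obj C" "u \<in> Arr C c d" "v \<in> carrier (OMap f c)" for c d u v
    proof -
      have "Comp C x c d u (Comp C x (OMap T c) c (\<theta> c) (\<iota> c v)) =
          Comp C x (OMap T c) d (Comp C (OMap T c) c d u (\<theta> c)) (\<iota> c v)"
        using that \<iota> by simp
      also have "\<dots> = Comp C x (OMap T d) d (\<theta> d) (Comp C x (OMap T c) (OMap T d) (AMap T c d u) (\<iota> c v))"
        using that \<iota> by (subst \<theta>_nat) simp_all
      finally show ?thesis
        using that by (simp add: T)
    qed
  qed (simp_all add: assms C lin_f)
  show ?thesis
    by (rule two_module_equivalentI[OF C linear_category_Vect f fully_faithful
          essentially_surjective[OF adj_f]])
qed

end
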